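(* Let $m>0$, $n>0$, $k>0$ and let $\alpha=\alpha_1+i\alpha_2$ with $\alpha_1,\alpha_2\in\mathbb{R}$, $\alpha_1^2+\alpha_2^2\neq 0$. Let $\widetilde{\mu_{1l}}$ ($l=1,2,\dots$) and $\widetilde{\mu_{2p}}$ ($p=1,2,\dots$) be the roots of the equations $J_{1/(n+2)}(x)=0$ and $J_{1/(m+2)}(y)=0$, respectively, where $J_\nu$ is the Bessel function of the first kind of order $\nu$, and put $$\mu_{1l}=\left(\tfrac{n+2}{2}\,\widetilde{\mu_{1l}}\right)^2,\qquad \mu_{2p}=\left(\tfrac{m+2}{2}\,\widetilde{\mu_{2p}}\right)^2,\qquad \mu_{lp}=\mu_{1l}+\mu_{2p}.$$ Write $\lambda=\lambda_1+i\lambda_2$ with $\lambda_1,\lambda_2\in\mathbb{R}$. The eigenvalue problem $$T'(t)+(\lambda+\mu_{lp})t^kT(t)=0,\qquad T(0)=\alpha T(1),$$ has a non-trivial solution only when $$\frac{\alpha_1}{\alpha_1^2+\alpha_2^2}=e^{-\frac{\lambda_1+\mu_{lp}}{k+1}}\cos\frac{\lambda_2}{k+1},\qquad \frac{\alpha_2}{\alpha_1^2+\alpha_2^2}=e^{-\frac{\lambda_1+\mu_{lp}}{k+1}}\sin\frac{\lambda_2}{k+1},$$ which gives $$\lambda_1=-\mu_{lp}+\tfrac{k+1}{2}\ln(\alpha_1^2+\alpha_2^2),\qquad \lambda_2=(k+1)\left[\arctan\tfrac{\alpha_2}{\alpha_1}+s\pi\right],\qquad s\in\mathbb{Z}^+,$$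 and the corresponding eigenfunctions are $$T_s(t)=C_s\,e^{\left[-\ln\sqrt{\alpha_1^2+\alpha_2^2}-i\left(\arctan\frac{\alpha_2}{\alpha_1}+s\pi\right)\right]t^{k+1}}.$$ For these values of $\lambda$, non-trivial solutions of Problem 1 (defined in the context) can be written in the form $$u_{lps}(x,y,t)=D_{lps}\left(\tfrac{2}{n+2}\right)^{\frac1{n+2}}\left(\tfrac{2}{m+2}\right)^{\frac1{m+2}}\mu_{1l}^{\frac{1}{2(n+2)}}\mu_{2p}^{\frac1{2(m+2)}}\sqrt{xy}\; J_{\frac1{n+2}}\!\left(\tfrac{2\sqrt{\mu_{1l}}}{n+2}x^{\frac{n+2}{2}}\right) J_{\frac1{m+2}}\!\left(\tfrac{2\sqrt{\mu_{2p}}}{m+2}y^{\frac{m+2}{2}}\right) e^{\left[-\ln\sqrt{\alpha_1^2+\alpha_2^2}-i\left(\arctan\frac{\alpha_2}{\alpha_1}+s\pi\right)\right]t^{k+1}},$$ with $l,p=1,2,\dots$, $s\in\mathbb{Z}^+$, where $D_{lps}$ are constants.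
   Context: Let $\Omega=\{(x,y,t)\in\mathbb{R}^3: 0<x<1,\ 0<y<1,\ 0<t<1\}$ be the open unit cube, with faces $S_2=\{x=1,\ 0<y<1,\ 0<t<1\}$, $S_3=\{y=0,\ 0<x<1,\ 0<t<1\}$, $S_4=\{x=0,\ 0<y<1,\ 0<t<1\}$, $S_5=\{y=1,\ 0<x<1,\ 0<t<1\}$. Problem 1: find a function $u(x,y,t)$ (complex-valued) such that (1) $u\in C(\overline{\Omega})\cap C^{2,2,1}_{x,y,t}(\Omega)$, i.e. $u$ is continuous on $\overline\Omega$ and is twice continuously differentiable in $x$, twice in $y$ and once in $t$ in $\Omega$; (2) $u$ satisfies in $\Omega$ the degenerate parabolic equation $$x^n y^m u_t = t^k y^m u_{xx} + t^k x^n u_{yy} - \lambda t^k x^n y^m u;$$ (3) $u=0$ on $S_2\cup S_3\cup S_4\cup S_5$; (4) $u(x,y,0)=\alpha\, u(x,y,1)$ (non-local condition). The solutions are sought in the separated form $u(x,y,t)=X(x)Y(y)T(t)$, where $X''+\mu_1x^nX=0$, $X(0)=X(1)=0$; $Y''+\mu_2y^mY=0$, $Y(0)=Y(1)=0$; and $T'+(\lambda+\mu)t^kT=0$, $T(0)=\alpha T(1)$, with $\mu=\mu_1+\mu_2$. The numbers $\mu_{1l}$ and $\mu_{2p}$ are the eigenvalues of the $X$- and $Y$-problems. If $A_l$, $B_p$, $C_s$ denote the constant factors of the eigenfunctions $X_l$, $Y_p$, $T_s$, then $D_{lps}=A_l\cdot B_p\cdot C_s$.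
   Formalization: Instead of all s in Z^+, s ranges over even integers if α1≥0 and odd integers if α1<0, negatives included: other parity violates T(0)=αT(1) (e.g. α=1, s=1), and negative s occur. At α1=0, arctan(α2/α1) is read as ±π/2 by the sign of α2. *)

theory Defs
  imports "HOL-Analysis.Analysis"
begin

text \<open>Bessel function of the first kind, real order, on the half line \<open>x \<ge> 0\<close>
  (for \<open>x < 0\<close> the real power is not meaningful; only orders \<open>\<nu> > 0\<close> are used,
  and there the series gives the correct value 0 at \<open>x = 0\<close>).\<close>

definition bessel_J :: "real \<Rightarrow> real \<Rightarrow> real" where
  "bessel_J \<nu> x =
     (\<Sum>j. (-1) ^ j / (fact j * Gamma (\<nu> + real j + 1)) * (x / 2) powr (2 * real j + \<nu>))"

definition Omega :: "(real \<times> real \<times> real) set" where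
  "Omega = {0<..<1} \<times> {0<..<1} \<times> {0<..<1}"

definition S2 :: "(real \<times> real \<times> real) set" where
  "S2 = {1} \<times> {0<..<1} \<times> {0<..<1}"

definition S3 :: "(real \<times> real \<times> real) set" where
  "S3 = {0<..<1} \<times> {0} \<times> {0<..<1}"

definition S4 :: "(real \<times> real \<times> real) set" where
  "S4 = {0} \<times> {0<..<1} \<times> {0<..<1}"

definition S5 :: "(real \<times> real \<times> real) set" where
  "S5 = {0<..<1} \<times> {1} \<times> {0<..<1}"

definition d_x :: "(real \<times> real \<times> real \<Rightarrow> complex) \<Rightarrow> real \<times> real \<times> real \<Rightarrow> complex" where
  "d_x u = (\<lambda>(x, y, t). vector_derivative (\<lambda>\<xi>. u (\<xi>, y, t)) (at x))"

definition d_y :: "(real \<times> real \<times> real \<Rightarrow> complex) \<Rightarrow> real \<times> real \<times> real \<Rightarrow> complex" where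
  "d_y u = (\<lambda>(x, y, t). vector_derivative (\<lambda>\<eta>. u (x, \<eta>, t)) (at y))"

definition d_t :: "(real \<times> real \<times> real \<Rightarrow> complex) \<Rightarrow> real \<times> real \<times> real \<Rightarrow> complex" where
  "d_t u = (\<lambda>(x, y, t). vector_derivative (\<lambda>\<tau>. u (x, y, \<tau>)) (at t))"

text \<open>The class \<open>C\<close> with indices \<open>2,2,1\<close> in \<open>x,y,t\<close>: pure derivatives only, no mixed ones,
  each continuous jointly in the three variables.\<close>

definition C221 :: "(real \<times> real \<times> real \<Rightarrow> complex) \<Rightarrow> bool" where
  "C221 u \<longleftrightarrow>
     (\<forall>(x, y, t) \<in> Omega.
        (\<lambda>\<xi>. u (\<xi>, y, t)) differentiable (at x) \<and>
        (\<lambda>\<xi>. d_x u (\<xi>, y, t)) differentiable (at x) \<and>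
        (\<lambda>\<eta>. u (x, \<eta>, t)) differentiable (at y) \<and>
        (\<lambda>\<eta>. d_y u (x, \<eta>, t)) differentiable (at y) \<and>
        (\<lambda>\<tau>. u (x, y, \<tau>)) differentiable (at t)) \<and>
     continuous_on Omega u \<and>
     continuous_on Omega (d_x u) \<and> continuous_on Omega (d_x (d_x u)) \<and>
     continuous_on Omega (d_y u) \<and> continuous_on Omega (d_y (d_y u)) \<and>
     continuous_on Omega (d_t u)"

definition problem1 ::
  "real \<Rightarrow> real \<Rightarrow> real \<Rightarrow> complex \<Rightarrow> complex \<Rightarrow> (real \<times> real \<times> real \<Rightarrow> complex) \<Rightarrow> bool" where
  "problem1 n m k lam \<alpha> u \<longleftrightarrow>
     continuous_on (closure Omega) u \<and> C221 u \<and>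
     (\<forall>(x, y, t) \<in> Omega.
        of_real (x powr n * y powr m) * d_t u (x, y, t) =
          of_real (t powr k * y powr m) * d_x (d_x u) (x, y, t)
          + of_real (t powr k * x powr n) * d_y (d_y u) (x, y, t)
          - lam * of_real (t powr k * x powr n * y powr m) * u (x, y, t)) \<and>
     (\<forall>p \<in> S2 \<union> S3 \<union> S4 \<union> S5. u p = 0) \<and>
     (\<forall>x \<in> {0..1}. \<forall>y \<in> {0..1}. u (x, y, 0) = \<alpha> * u (x, y, 1))"

definition T_problem ::
  "real \<Rightarrow> complex \<Rightarrow> complex \<Rightarrow> real \<Rightarrow> (real \<Rightarrow> complex) \<Rightarrow> bool" where
  "T_problem k \<alpha> lam \<mu> T \<longleftrightarrow>
     continuous_on {0..1} T \<and>
     (\<forall>t \<in> {0<..<1}. T differentiable (at t) \<and>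
        vector_derivative T (at t) + (lam + of_real \<mu>) * of_real (t powr k) * T t = 0) \<and>
     T 0 = \<alpha> * T 1"

text \<open>\<open>arctan (b / a)\<close>, read as the limit value \<open>\<plusminus> \<pi> / 2\<close> when \<open>a = 0\<close>
  (in HOL one has \<open>b / 0 = 0\<close>).\<close>

definition arctan_ratio :: "real \<Rightarrow> real \<Rightarrow> real" where
  "arctan_ratio b a = (if a = 0 then sgn b * pi / 2 else arctan (b / a))"

text \<open>\<open>arctan_ratio \<alpha>2 \<alpha>1 + s * pi\<close> is an argument of \<open>\<alpha>1 + \<i> \<alpha>2\<close> for only one parity of \<open>s\<close>;
  with the other parity it is an argument of the negative of that number.\<close>

definition admissible :: "real \<Rightarrow> int set" where
  "admissible \<alpha>1 = {s. even s \<longleftrightarrow> 0 \<le> \<alpha>1}"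

definition lambda1 :: "real \<Rightarrow> real \<Rightarrow> real \<Rightarrow> real \<Rightarrow> real" where
  "lambda1 k \<alpha>1 \<alpha>2 \<mu> = - \<mu> + (k + 1) / 2 * ln (\<alpha>1\<^sup>2 + \<alpha>2\<^sup>2)"

definition lambda2 :: "real \<Rightarrow> real \<Rightarrow> real \<Rightarrow> int \<Rightarrow> real" where
  "lambda2 k \<alpha>1 \<alpha>2 s = (k + 1) * (arctan_ratio \<alpha>2 \<alpha>1 + of_int s * pi)"

definition time_factor :: "real \<Rightarrow> real \<Rightarrow> real \<Rightarrow> int \<Rightarrow> real \<Rightarrow> complex" where
  "time_factor k \<alpha>1 \<alpha>2 s t =
     exp ((- of_real (ln (sqrt (\<alpha>1\<^sup>2 + \<alpha>2\<^sup>2)))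
           - \<i> * of_real (arctan_ratio \<alpha>2 \<alpha>1 + of_int s * pi)) * of_real (t powr (k + 1)))"

definition u_sol ::
  "real \<Rightarrow> real \<Rightarrow> real \<Rightarrow> real \<Rightarrow> real \<Rightarrow> real \<Rightarrow> real \<Rightarrow> int \<Rightarrow> complex
     \<Rightarrow> real \<times> real \<times> real \<Rightarrow> complex" where
  "u_sol n m k \<alpha>1 \<alpha>2 \<mu>1 \<mu>2 s D = (\<lambda>(x, y, t).
     D * of_real ((2 / (n + 2)) powr (1 / (n + 2)) * (2 / (m + 2)) powr (1 / (m + 2))
        * \<mu>1 powr (1 / (2 * (n + 2))) * \<mu>2 powr (1 / (2 * (m + 2)))
        * sqrt (x * y)
        * bessel_J (1 / (n + 2)) (2 * sqrt \<mu>1 / (n + 2) * x powr ((n + 2) / 2))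
        * bessel_J (1 / (m + 2)) (2 * sqrt \<mu>2 / (m + 2) * y powr ((m + 2) / 2)))
     * time_factor k \<alpha>1 \<alpha>2 s t)"

end

theory Submission
  imports Defs
begin

text \<open>
  For a separated solution each factor solves an ordinary differential equation with an a priori
  complex constant. For \<open>X'' = - \<mu> x\<^sup>n X\<close> with Dirichlet conditions the function \<open>X' * cnj X\<close>
  vanishes at both ends of the interval, while its imaginary part is monotone with slope
  \<open>- Im \<mu> x\<^sup>n \<bar>X\<bar>\<^sup>2\<close>; so \<open>\<mu>\<close> is real, and the real part, with slope
  \<open>\<bar>X'\<bar>\<^sup>2 - \<mu> x\<^sup>n \<bar>X\<bar>\<^sup>2\<close>, then forces \<open>\<mu> > 0\<close>. A Gronwall estimate at the degenerate
  point \<open>x = 0\<close> shows that \<open>X\<close> is a multiple of \<open>sqrt x * J\<^sub>\<nu> (z x powr ((n + 2) / 2))\<close>, which equals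
  a constant times \<open>x F((z / 2)\<^sup>2 x powr (n + 2))\<close> with an entire \<open>F\<close> and is therefore smooth enough
  up to \<open>x = 0\<close>. Hence \<open>\<mu>\<close> comes from a positive zero of \<open>J\<^sub>\<nu>\<close>. The time equation is explicitly
  solvable, and the non-local condition becomes \<open>exp ((\<lambda> + \<mu>) / (k + 1)) = \<alpha>\<close>.
\<close>

section \<open>Bessel functions and the weighted string equation\<close>

definition bessel_coeff :: "real \<Rightarrow> nat \<Rightarrow> real" where
  "bessel_coeff \<nu> j = (-1) ^ j / (fact j * Gamma (\<nu> + real j + 1))"

text \<open>The entire factor in \<open>J_\<nu>(x) = (x/2)^\<nu> * F((x/2)^2)\<close>: splitting off
  the non-integer power leaves a power series in \<open>w = (x/2)^2\<close>. Up to the factor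
  \<open>1 / Gamma (\<nu> + 1)\<close> it is the hypergeometric function 0F1 with parameter
  \<open>\<nu> + 1\<close> at \<open>- w\<close>.\<close>

definition bessel_F :: "real \<Rightarrow> real \<Rightarrow> real" where
  "bessel_F \<nu> w = (\<Sum>j. bessel_coeff \<nu> j * w ^ j)"

definition bessel_F1 :: "real \<Rightarrow> real \<Rightarrow> real" where
  "bessel_F1 \<nu> w = (\<Sum>j. diffs (bessel_coeff \<nu>) j * w ^ j)"

definition bessel_F2 :: "real \<Rightarrow> real \<Rightarrow> real" where
  "bessel_F2 \<nu> w = (\<Sum>j. diffs (diffs (bessel_coeff \<nu>)) j * w ^ j)"

text \<open>The functional equation of Gamma at the positive point
  \<open>\<nu> + real j + 1\<close>. The recurrence is the differential equation of
  \<open>bessel_F\<close> read coefficient by coefficient, and it also controls the size of the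
  coefficients.\<close>

lemma bessel_coeff_Suc:
  assumes "\<nu> > 0"
  shows "bessel_coeff \<nu> (Suc j) * real (Suc j) * (\<nu> + real j + 1) = - bessel_coeff \<nu> j"
proof -
  have p: "\<nu> + real j + 1 > 0" using assms by linarith
  have "Gamma (\<nu> + real j + 1 + 1) = (\<nu> + real j + 1) * Gamma (\<nu> + real j + 1)"
    using p by (intro Gamma_plus1) (auto elim: nonpos_Ints_cases)
  hence G: "Gamma (\<nu> + real (Suc j) + 1) = (\<nu> + real j + 1) * Gamma (\<nu> + real j + 1)"
    by (simp add: algebra_simps)
  have "Gamma (\<nu> + real j + 1) > 0" using p by (rule Gamma_real_pos)
  moreover have "real (Suc j) > 0" by simp
  moreover define g P where "g = Gamma (\<nu> + real j + 1)" and "P = \<nu> + real j + 1"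
  ultimately show ?thesis
    using p unfolding bessel_coeff_def G fact_Suc of_nat_mult g_def[symmetric] P_def[symmetric]
    by (simp add: divide_simps del: of_nat_Suc)
qed

text \<open>In the recurrence the factor \<open>\<nu> + real j + 1\<close> is at least 1. Dropping
  it bounds the coefficients by a constant over \<open>fact j\<close>, so the exponential series
  dominates for every \<open>w\<close>.\<close>

lemma summable_bessel_coeff:
  assumes "\<nu> > 0"
  shows "summable (\<lambda>j. bessel_coeff \<nu> j * w ^ j)"
proof -
  have le: "\<bar>bessel_coeff \<nu> j\<bar> \<le> \<bar>bessel_coeff \<nu> 0\<bar> * inverse (fact j)" for j
  proof (induction j)
    case (Suc j)
    have p: "\<nu> + real j + 1 \<ge> 1" using assms by linarith
    have "\<bar>bessel_coeff \<nu> (Suc j)\<bar> * real (Suc j) * 1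
        \<le> \<bar>bessel_coeff \<nu> (Suc j)\<bar> * real (Suc j) * (\<nu> + real j + 1)"
      using p by (intro mult_left_mono) auto
    also have "\<dots> = \<bar>bessel_coeff \<nu> (Suc j) * real (Suc j) * (\<nu> + real j + 1)\<bar>"
      using p by (simp add: abs_mult)
    also have "\<dots> = \<bar>bessel_coeff \<nu> j\<bar>"
      using bessel_coeff_Suc[OF assms, of j] by simp
    finally have "\<bar>bessel_coeff \<nu> (Suc j)\<bar> * real (Suc j) \<le> \<bar>bessel_coeff \<nu> 0\<bar> * inverse (fact j)"
      using Suc by linarith
    moreover have "real (Suc j) > 0" by simp
    ultimately show ?case
      unfolding fact_Suc of_nat_mult by (simp add: field_simps del: of_nat_Suc)
  qed simp
  show ?thesis
  proof (rule summable_comparison_test')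
    show "summable (\<lambda>j. \<bar>bessel_coeff \<nu> 0\<bar> * (inverse (fact j) * \<bar>w\<bar> ^ j))"
      by (intro summable_mult summable_exp)
    show "norm (bessel_coeff \<nu> j * w ^ j) \<le> \<bar>bessel_coeff \<nu> 0\<bar> * (inverse (fact j) * \<bar>w\<bar> ^ j)" for j
      using mult_right_mono[OF le[of j], of "\<bar>w\<bar> ^ j"] by (simp add: abs_mult power_abs mult.assoc)
  qed
qed

lemma summable_diffs_bessel_coeff:
  "\<nu> > 0 \<Longrightarrow> summable (\<lambda>j. diffs (bessel_coeff \<nu>) j * w ^ j)"
  by (rule termdiff_converges_all) (rule summable_bessel_coeff)

lemma summable_diffs_diffs_bessel_coeff:
  "\<nu> > 0 \<Longrightarrow> summable (\<lambda>j. diffs (diffs (bessel_coeff \<nu>)) j * w ^ j)"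
  by (rule termdiff_converges_all) (rule summable_diffs_bessel_coeff)

lemma DERIV_bessel_F:
  assumes "\<nu> > 0" shows "(bessel_F \<nu> has_real_derivative bessel_F1 \<nu> w) (at w)"
  unfolding bessel_F_def[abs_def] bessel_F1_def
  using assms by (intro termdiffs_strong_converges_everywhere summable_bessel_coeff)

lemma DERIV_bessel_F1:
  assumes "\<nu> > 0" shows "(bessel_F1 \<nu> has_real_derivative bessel_F2 \<nu> w) (at w)"
  unfolding bessel_F1_def[abs_def] bessel_F2_def
  using assms by (intro termdiffs_strong_converges_everywhere summable_diffs_bessel_coeff)

lemma continuous_on_bessel_F [continuous_intros]:
  "\<nu> > 0 \<Longrightarrow> continuous_on A f \<Longrightarrow> continuous_on A (\<lambda>x. bessel_F \<nu> (f x))"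
  by (rule continuous_on_compose2[of UNIV "bessel_F \<nu>"])
     (auto intro!: continuous_at_imp_continuous_on DERIV_isCont DERIV_bessel_F)

lemma continuous_on_bessel_F1 [continuous_intros]:
  "\<nu> > 0 \<Longrightarrow> continuous_on A f \<Longrightarrow> continuous_on A (\<lambda>x. bessel_F1 \<nu> (f x))"
  by (rule continuous_on_compose2[of UNIV "bessel_F1 \<nu>"])
     (auto intro!: continuous_at_imp_continuous_on DERIV_isCont DERIV_bessel_F1)

lemma bessel_F_0: "bessel_F \<nu> 0 = inverse (Gamma (\<nu> + 1))"
proof -
  have "bessel_F \<nu> 0 = bessel_coeff \<nu> 0"
    unfolding bessel_F_def by (rule powser_zero)
  thus ?thesis by (simp add: bessel_coeff_def inverse_eq_divide)
qed

text \<open>Bessel's equation after the substitution \<open>w = (x/2)^2\<close>; the coefficient of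
  \<open>w ^ j\<close> is exactly the recurrence \<open>bessel_coeff_Suc\<close>.\<close>

lemma bessel_F_ode:
  assumes "\<nu> > 0"
  shows "w * bessel_F2 \<nu> w + (\<nu> + 1) * bessel_F1 \<nu> w = - bessel_F \<nu> w"
proof -
  \<comment> \<open>The terms of the series for \<open>w * bessel_F2 \<nu> w\<close>, with the index
    shifted because of the extra factor \<open>w\<close>; since \<open>b 0 = 0\<close>, the shifted
    sum may start at 0 again.\<close>
  define b where "b j = real j * diffs (bessel_coeff \<nu>) j * w ^ j" for j
  have s2: "(\<lambda>j. w * (diffs (diffs (bessel_coeff \<nu>)) j * w ^ j)) sums (w * bessel_F2 \<nu> w)"
    unfolding bessel_F2_def
    by (intro sums_mult summable_sums summable_diffs_diffs_bessel_coeff assms)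
  have "(\<lambda>j. b (Suc j)) sums (w * bessel_F2 \<nu> w)"
    using s2 by (simp add: b_def diffs_def mult_ac)
  hence "b sums (w * bessel_F2 \<nu> w)"
    by (subst (asm) sums_Suc_iff) (simp add: b_def)
  moreover have "(\<lambda>j. (\<nu> + 1) * (diffs (bessel_coeff \<nu>) j * w ^ j)) sums ((\<nu> + 1) * bessel_F1 \<nu> w)"
    unfolding bessel_F1_def
    by (intro sums_mult summable_sums summable_diffs_bessel_coeff assms)
  ultimately have "(\<lambda>j. b j + (\<nu> + 1) * (diffs (bessel_coeff \<nu>) j * w ^ j))
      sums (w * bessel_F2 \<nu> w + (\<nu> + 1) * bessel_F1 \<nu> w)"
    by (rule sums_add)
  also have "(\<lambda>j. b j + (\<nu> + 1) * (diffs (bessel_coeff \<nu>) j * w ^ j))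
      = (\<lambda>j. - (bessel_coeff \<nu> j * w ^ j))"
  proof
    fix j
    have "b j + (\<nu> + 1) * (diffs (bessel_coeff \<nu>) j * w ^ j)
        = bessel_coeff \<nu> (Suc j) * real (Suc j) * (\<nu> + real j + 1) * w ^ j"
      by (simp add: b_def diffs_def algebra_simps)
    thus "b j + (\<nu> + 1) * (diffs (bessel_coeff \<nu>) j * w ^ j) = - (bessel_coeff \<nu> j * w ^ j)"
      using bessel_coeff_Suc[OF assms, of j] by simp
  qed
  finally have "(\<lambda>j. - (bessel_coeff \<nu> j * w ^ j)) sums (w * bessel_F2 \<nu> w + (\<nu> + 1) * bessel_F1 \<nu> w)" .
  moreover have "(\<lambda>j. - (bessel_coeff \<nu> j * w ^ j)) sums (- bessel_F \<nu> w)"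
    unfolding bessel_F_def by (intro sums_minus summable_sums summable_bessel_coeff assms)
  ultimately show ?thesis by (rule sums_unique2)
qed

lemma bessel_J_eq_bessel_F:
  assumes "\<nu> > 0" "x \<ge> 0"
  shows "bessel_J \<nu> x = (x / 2) powr \<nu> * bessel_F \<nu> ((x / 2)\<^sup>2)"
proof (cases "x = 0")
  case False
  hence p: "x / 2 > 0" using assms by simp
  have "(x / 2) powr (2 * real j + \<nu>) = (x / 2) powr \<nu> * ((x / 2)\<^sup>2) ^ j" for j
  proof -
    have "(x / 2) powr (2 * real j) = (x / 2) ^ (2 * j)"
      using powr_realpow[OF p, of "2 * j"] by simp
    thus ?thesis by (simp add: powr_add power_mult del: power_divide)
  qed
  hence "bessel_J \<nu> x = (\<Sum>j. (x / 2) powr \<nu> * (bessel_coeff \<nu> j * ((x / 2)\<^sup>2) ^ j))"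
    unfolding bessel_J_def bessel_coeff_def by (simp only: mult_ac)
  also have "\<dots> = (x / 2) powr \<nu> * bessel_F \<nu> ((x / 2)\<^sup>2)"
    unfolding bessel_F_def by (intro suminf_mult summable_bessel_coeff assms)
  finally show ?thesis .
\<comment> \<open>At \<open>x = 0\<close> both sides vanish, because
  \<open>0 powr a = 0\<close>.\<close>
qed (simp add: bessel_J_def)

text \<open>The solution of \<open>X'' = - (n + 2)\<^sup>2 * c * x powr n * X\<close> that vanishes
  at 0. For \<open>c = (z / 2)\<^sup>2\<close> it is a constant multiple of
  \<open>sqrt x * J_\<nu> (z * x powr ((n + 2) / 2))\<close> with
  \<open>\<nu> = 1 / (n + 2)\<close>, but written without square root or Bessel power, so that its
  behaviour at 0 is visible.\<close>

definition profile :: "real \<Rightarrow> real \<Rightarrow> real \<Rightarrow> real" where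
  "profile n c x = x * bessel_F (1 / (n + 2)) (c * x powr (n + 2))"

text \<open>The derivative of \<open>profile\<close> for \<open>x > 0\<close>, with
  \<open>x * x powr (n + 1)\<close> combined into \<open>x powr (n + 2)\<close>; in this form it is
  continuous down to \<open>x = 0\<close>, where its value is \<open>1 / Gamma (\<nu> + 1)\<close>
  with \<open>\<nu> = 1 / (n + 2)\<close>.\<close>

definition profile' :: "real \<Rightarrow> real \<Rightarrow> real \<Rightarrow> real" where
  "profile' n c x = bessel_F (1 / (n + 2)) (c * x powr (n + 2))
     + (n + 2) * (c * x powr (n + 2)) * bessel_F1 (1 / (n + 2)) (c * x powr (n + 2))"

text \<open>With \<open>\<nu> = 1 / (n + 2)\<close> the exponents fit together: the power \<nu> of
  the Bessel argument contributes a second \<open>sqrt x\<close>, giving the factor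
  \<open>x\<close>, and the square of half the argument gives \<open>x powr (n + 2)\<close>.\<close>

lemma sqrt_bessel_J_eq_profile:
  assumes "n > 0" "z > 0" "x \<ge> 0"
  shows "sqrt x * bessel_J (1 / (n + 2)) (z * x powr ((n + 2) / 2))
    = (z / 2) powr (1 / (n + 2)) * profile n ((z / 2)\<^sup>2) x"
proof (cases "x = 0")
  case False
  hence x: "x > 0" using assms by simp
  have e: "z * x powr ((n + 2) / 2) / 2 = (z / 2) * x powr ((n + 2) / 2)" by simp
  have 1: "(z / 2 * x powr ((n + 2) / 2)) powr (1 / (n + 2)) = (z / 2) powr (1 / (n + 2)) * sqrt x"
  proof -
    have "(n + 2) / 2 * (1 / (n + 2)) = 1 / 2" using assms by (simp add: field_simps)
    hence "(x powr ((n + 2) / 2)) powr (1 / (n + 2)) = sqrt x"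
      using x by (simp only: powr_powr powr_half_sqrt)
    thus ?thesis using assms by (subst powr_mult) simp_all
  qed
  have 2: "(z / 2 * x powr ((n + 2) / 2))\<^sup>2 = (z / 2)\<^sup>2 * x powr (n + 2)"
    using x by (simp add: power_mult_distrib power2_eq_square flip: powr_add)
  have "bessel_J (1 / (n + 2)) (z * x powr ((n + 2) / 2)) = (z / 2) powr (1 / (n + 2)) * sqrt x
      * bessel_F (1 / (n + 2)) ((z / 2)\<^sup>2 * x powr (n + 2))"
    using assms by (subst bessel_J_eq_bessel_F) (simp_all only: e 1 2, auto)
  thus ?thesis using x by (simp add: profile_def)
qed (simp add: profile_def)

section \<open>Regularity and non-vanishing of the profile\<close>

lemma continuous_on_powr_nonneg:
  fixes a :: real assumes "a > 0" shows "continuous_on {0..} (\<lambda>x. x powr a)"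
  using assms by (intro continuous_on_powr') (auto intro: continuous_intros)

lemma continuous_on_profile:
  assumes "n > 0" shows "continuous_on {0..} (profile n c)"
  unfolding profile_def[abs_def] using assms
  by (auto intro!: continuous_intros continuous_on_powr_nonneg)

lemma continuous_on_profile':
  assumes "n > 0" shows "continuous_on {0..} (profile' n c)"
  unfolding profile'_def[abs_def] using assms
  by (auto intro!: continuous_intros continuous_on_powr_nonneg)

lemma profile'_0_pos: "n > 0 \<Longrightarrow> profile' n c 0 > 0"
  by (simp add: profile'_def bessel_F_0 Gamma_real_pos add_pos_pos)

lemma DERIV_profile:
  assumes "n > 0" "x > 0"
  shows "(profile n c has_real_derivative profile' n c x) (at x)"
proof -
  have xp: "x * x powr (n + 1) = x powr (n + 2)"
    using assms by (simp add: powr_add power2_eq_square)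
  show ?thesis
    unfolding profile_def[abs_def] profile'_def using assms
    apply (auto intro!: derivative_eq_intros DERIV_chain2[OF DERIV_bessel_F])
    using xp by (simp add: algebra_simps)
qed

lemma DERIV_profile':
  assumes "n > 0" "x > 0"
  shows "(profile' n c has_real_derivative - ((n + 2)\<^sup>2 * c * x powr n * profile n c x)) (at x)"
proof -
  define \<nu> w where "\<nu> = 1 / (n + 2)" and "w = c * x powr (n + 2)"
  have nu: "\<nu> > 0" "(n + 2) * \<nu> = 1" using assms by (auto simp: \<nu>_def)
  define dw where "dw = c * ((n + 2) * x powr (n + 1))"
  have xp: "x powr (n + 1) = x powr n * x" using assms by (simp add: powr_add)
  have D: "(profile' n c has_real_derivative bessel_F1 \<nu> w * dw
      + (n + 2) * dw * bessel_F1 \<nu> w + (n + 2) * w * (bessel_F2 \<nu> w * dw)) (at x)"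
    unfolding profile'_def[abs_def] using assms nu
    by (auto intro!: derivative_eq_intros DERIV_chain2[OF DERIV_bessel_F] DERIV_chain2[OF DERIV_bessel_F1]
        simp: \<nu>_def w_def dw_def algebra_simps)
  \<comment> \<open>Writing the coefficient 1 of the first term as \<open>(n + 2) * \<nu>\<close>
    completes the bracket to \<open>n + 2\<close> times the left side of
    \<open>bessel_F_ode\<close>.\<close>
  have "bessel_F1 \<nu> w * dw + (n + 2) * dw * bessel_F1 \<nu> w + (n + 2) * w * (bessel_F2 \<nu> w * dw)
      = dw * (((n + 2) * \<nu>) * bessel_F1 \<nu> w + (n + 2) * bessel_F1 \<nu> w + (n + 2) * (w * bessel_F2 \<nu> w))"
    by (simp only: nu) (simp add: algebra_simps)
  also have "\<dots> = dw * (n + 2) * (w * bessel_F2 \<nu> w + (\<nu> + 1) * bessel_F1 \<nu> w)"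
    by (simp add: algebra_simps)
  also have "\<dots> = - ((n + 2)\<^sup>2 * c * x powr n * profile n c x)"
    unfolding bessel_F_ode[OF nu(1)]
    by (simp add: profile_def dw_def xp power2_eq_square \<nu>_def w_def)
  finally show ?thesis using D by simp
qed

text \<open>\<open>bessel_F\<close> is positive at 0, hence by continuity near 0, and there
  \<open>profile\<close> is a positive \<open>x\<close> times a positive number. This yields the
  non-triviality of the constructed solutions.\<close>

lemma profile_nonzero:
  assumes "n > 0"
  obtains x where "0 < x" "x < 1" "profile n c x \<noteq> 0"
proof -
  define g where "g x = bessel_F (1 / (n + 2)) (c * x powr (n + 2))" for x
  have "continuous_on {0..} g"
    unfolding g_def[abs_def] using assms by (auto intro!: continuous_intros continuous_on_powr_nonneg)
  hence "(g \<longlongrightarrow> g 0) (at 0 within {0..})" by (auto simp: continuous_on_def)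
  hence "(g \<longlongrightarrow> g 0) (at_right 0)" by (rule tendsto_within_subset) auto
  moreover have "g 0 > 0" using assms by (simp add: g_def bessel_F_0 Gamma_real_pos add_pos_pos)
  ultimately have "eventually (\<lambda>x. g x > 0) (at_right 0)" by (rule order_tendstoD)
  moreover have "eventually (\<lambda>x::real. x \<in> {0<..<1}) (at_right 0)" by (rule eventually_at_right_real) simp
  ultimately have "eventually (\<lambda>x. g x > 0 \<and> x \<in> {0<..<1}) (at_right 0)" by (rule eventually_conj)
  then obtain x where "g x > 0" "x \<in> {0<..<1}"
    using eventually_happens'[OF trivial_limit_at_right_real] by blast
  thus thesis by (intro that[of x]) (auto simp: profile_def g_def)
qed

lemma bessel_J_zero_iff_profile:
  assumes "n > 0" "z > 0"
  shows "bessel_J (1 / (n + 2)) z = 0 \<longleftrightarrow> profile n ((z / 2)\<^sup>2) 1 = 0"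
  using sqrt_bessel_J_eq_profile[OF assms, of 1] assms by (auto simp del: power_divide)

section \<open>The Dirichlet problem for the weighted string\<close>

lemma nonneg_derivative_eq_zero:
  fixes f :: "real \<Rightarrow> real"
  assumes "continuous_on {0..1} f" "f 0 = 0" "f 1 = 0"
    and D: "\<And>x. 0 < x \<Longrightarrow> x < 1 \<Longrightarrow> (f has_real_derivative f' x) (at x)"
    and nonneg: "\<And>x. 0 < x \<Longrightarrow> x < 1 \<Longrightarrow> 0 \<le> f' x"
    and x: "0 < x" "x < 1"
  shows "f' x = 0"
proof -
  have mono: "f a \<le> f b" if "0 \<le> a" "a \<le> b" "b \<le> 1" for a b
  proof (rule DERIV_nonneg_imp_increasing_open[where f = f and a = a and b = b])
    show "\<exists>d. (f has_real_derivative d) (at x) \<and> 0 \<le> d" if "a < x" "x < b" for x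
      using D[of x] nonneg[of x] that \<open>0 \<le> a\<close> \<open>b \<le> 1\<close> by (intro exI[of _ "f' x"]) simp
    show "continuous_on {a..b} f"
      by (rule continuous_on_subset[OF assms(1)]) (use that in auto)
  qed (use that in auto)
  \<comment> \<open>By monotonicity \<open>f y\<close> lies between \<open>f 0\<close> and
    \<open>f 1\<close>, which are both 0; so \<open>f\<close> coincides inside with the zero
    function, and so does its derivative.\<close>
  have z: "f y = 0" if "y \<in> {0<..<1}" for y
    using mono[of 0 y] mono[of y 1] that assms(2,3) by simp
  have "((\<lambda>_. 0) has_real_derivative f' x) (at x)"
    using has_field_derivative_transform_within_open[OF D[OF x], of "{0<..<1}" "\<lambda>_. 0"] x z by auto
  thus ?thesis by (rule DERIV_unique) (rule DERIV_const)
qed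

text \<open>A bounded derivative makes \<open>f\<close> Lipschitz, hence uniformly continuous, and a
  uniformly continuous function extends to the closure. It serves to give the first derivative of an
  eigenfunction values at 0 and 1, where nothing is assumed about it.\<close>

lemma extend_bounded_derivative:
  fixes f :: "real \<Rightarrow> complex"
  assumes D: "\<And>x. 0 < x \<Longrightarrow> x < 1 \<Longrightarrow> (f has_vector_derivative f' x) (at x)"
    and B: "\<And>x. 0 < x \<Longrightarrow> x < 1 \<Longrightarrow> norm (f' x) \<le> B"
  obtains g where "continuous_on {0..1} g" "\<And>x. 0 < x \<Longrightarrow> x < 1 \<Longrightarrow> g x = f x"
proof -
  have B0: "0 \<le> B" using order_trans[OF norm_ge_zero B[of "1/2"]] by simp
  have "B-lipschitz_on {0<..<1} f"
  proof (rule lipschitz_onI)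
    fix x y :: real assume xy: "x \<in> {0<..<1}" "y \<in> {0<..<1}"
    have "norm (f x - f y) \<le> B * norm (x - y)"
    proof (rule differentiable_bound[where S = "{0<..<1}" and f' = "\<lambda>x h. h *\<^sub>R f' x"])
      fix z :: real assume z: "z \<in> {0<..<1}"
      show "(f has_derivative (\<lambda>h. h *\<^sub>R f' z)) (at z within {0<..<1})"
        using D[of z] z by (auto simp: has_vector_derivative_def intro: has_derivative_at_withinI)
      show "onorm (\<lambda>h. h *\<^sub>R f' z) \<le> B"
        using B[of z] z B0 by (intro onorm_bound) (auto simp: mult.commute[of B] intro: mult_left_mono)
    qed (use xy in auto)
    thus "dist (f x) (f y) \<le> B * dist x y" by (simp add: dist_norm)
  qed (rule B0)
  hence "uniformly_continuous_on {0<..<1} f" by (rule lipschitz_on_uniformly_continuous)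
  then obtain g where "uniformly_continuous_on (closure {0<..<1}) g" "\<And>x. x \<in> {0<..<1} \<Longrightarrow> f x = g x"
    by (rule uniformly_continuous_on_extension_on_closure) blast
  thus thesis by (intro that[of g]) (auto dest: uniformly_continuous_imp_continuous)
qed

lemma has_real_derivative_Re:
  "(f has_vector_derivative D) (at x) \<Longrightarrow> ((\<lambda>x. Re (f x)) has_real_derivative Re D) (at x)"
  unfolding has_real_derivative_iff_has_vector_derivative
  by (rule bounded_linear.has_vector_derivative[OF bounded_linear_Re])

lemma has_real_derivative_Im:
  "(f has_vector_derivative D) (at x) \<Longrightarrow> ((\<lambda>x. Im (f x)) has_real_derivative Im D) (at x)"
  unfolding has_real_derivative_iff_has_vector_derivative
  by (rule bounded_linear.has_vector_derivative[OF bounded_linear_Im])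

lemma has_vector_derivative_mult_cnj:
  assumes "(f has_vector_derivative f') (at x)" "(g has_vector_derivative g') (at x)"
  shows "((\<lambda>x. f x * cnj (g x)) has_vector_derivative (f x * cnj g' + f' * cnj (g x))) (at x)"
  by (intro has_vector_derivative_mult assms
      bounded_linear.has_vector_derivative[OF bounded_linear_cnj])

text \<open>The energy of the first-order system for \<open>(f, g)\<close> grows at most
  exponentially, since the weight \<open>x powr n\<close> is bounded by 1 on the interval; starting
  from 0 it stays 0. The degeneration of the weight at 0 is harmless for this estimate.\<close>

lemma weighted_string_unique:
  fixes f g :: "real \<Rightarrow> complex"
  assumes n: "n \<ge> 0" and "\<omega> \<ge> 0"
    and cont: "continuous_on {0..1} f" "continuous_on {0..1} g"
    and zero: "f 0 = 0" "g 0 = 0"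
    and D: "\<And>x. 0 < x \<Longrightarrow> x < 1 \<Longrightarrow> (f has_vector_derivative g x) (at x)"
      "\<And>x. 0 < x \<Longrightarrow> x < 1 \<Longrightarrow> (g has_vector_derivative - of_real (\<omega> * x powr n) * f x) (at x)"
    and x: "x \<in> {0..1}"
  shows "f x = 0"
proof -
  \<comment> \<open>The squared norms are written as real parts of \<open>f * cnj f\<close> and
    \<open>g * cnj g\<close>, so that the product rule for complex functions gives the derivative
    directly.\<close>
  define E where "E x = Re (f x * cnj (f x)) + Re (g x * cnj (g x))" for x
  define E' where "E' x = Re (f x * cnj (g x) + g x * cnj (f x))
    + Re (g x * cnj (- of_real (\<omega> * x powr n) * f x) + - of_real (\<omega> * x powr n) * f x * cnj (g x))" for x
  \<comment> \<open>The energy times the integrating factor that turns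
    \<open>E' \<le> (1 + \<omega>) * E\<close> into monotonicity.\<close>
  define h where "h x = E x * exp (- (1 + \<omega>) * x)" for x
  have E: "E x = (norm (f x))\<^sup>2 + (norm (g x))\<^sup>2" for x
    unfolding E_def cmod_power2 by (simp add: power2_eq_square)
  have DE: "(E has_real_derivative E' x) (at x)" if "0 < x" "x < 1" for x
    unfolding E_def[abs_def] E'_def
    by (intro DERIV_add has_real_derivative_Re has_vector_derivative_mult_cnj D that)
  \<comment> \<open>Gronwall for the energy: \<open>\<bar>f\<bar> \<bar>g\<bar> \<le> E / 2\<close>, and \<open>\<bar>1 - \<omega> x powr n\<bar> \<le> 1 + \<omega>\<close>.\<close>
  have E'_le: "E' x \<le> (1 + \<omega>) * E x" if "0 < x" "x < 1" for x
  proof -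
    define r where "r = Re (f x * cnj (g x))"
    define q where "q = \<omega> * x powr n"
    have "x powr n \<le> 1" using that n by (simp add: powr_le1)
    hence q: "0 \<le> q" "q \<le> \<omega>" using \<open>\<omega> \<ge> 0\<close> by (auto simp: q_def mult_left_le)
    have "E' x = 2 * (1 - q) * r"
      by (simp add: E'_def r_def algebra_simps flip: q_def)
    also have "\<dots> \<le> 2 * ((1 + \<omega>) * \<bar>r\<bar>)"
    proof -
      have "(1 - q) * r \<le> \<bar>1 - q\<bar> * \<bar>r\<bar>" by (metis abs_ge_self abs_mult)
      also have "\<dots> \<le> (1 + \<omega>) * \<bar>r\<bar>" using q by (intro mult_right_mono) auto
      finally show ?thesis by (simp only: mult.assoc)
    qed
    also have "\<dots> \<le> (1 + \<omega>) * E x"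
    proof -
      have "\<bar>r\<bar> \<le> norm (f x) * norm (g x)"
        unfolding r_def by (metis abs_Re_le_cmod complex_mod_cnj norm_mult)
      moreover have "2 * (norm (f x) * norm (g x)) \<le> E x"
        unfolding E using sum_squares_bound[of "norm (f x)" "norm (g x)"] by simp
      ultimately have "2 * \<bar>r\<bar> \<le> E x" by linarith
      hence "(1 + \<omega>) * (2 * \<bar>r\<bar>) \<le> (1 + \<omega>) * E x" using \<open>\<omega> \<ge> 0\<close> by (intro mult_left_mono) auto
      thus ?thesis by simp
    qed
    finally show ?thesis .
  qed
  have "h x \<le> h 0"
  proof (rule DERIV_nonpos_imp_decreasing_open[where f = h and a = 0 and b = x])
    fix y assume "0 < y" "y < x"
    hence y: "0 < y" "y < 1" using x by auto
    have "(h has_real_derivative (E' y - (1 + \<omega>) * E y) * exp (- (1 + \<omega>) * y)) (at y)"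
      unfolding h_def[abs_def]
      by (auto intro!: derivative_eq_intros DE[OF y] simp: algebra_simps)
    moreover have "(E' y - (1 + \<omega>) * E y) * exp (- (1 + \<omega>) * y) \<le> 0"
      using E'_le[OF y] by (intro mult_nonpos_nonneg) auto
    ultimately show "\<exists>d. (h has_real_derivative d) (at y) \<and> d \<le> 0" by blast
    next
    have "continuous_on {0..1} h" unfolding h_def[abs_def] E_def[abs_def]
      by (intro continuous_intros cont)
    thus "continuous_on {0..x} h" by (rule continuous_on_subset) (use x in auto)
  qed (use x in auto)
  also have "h 0 = 0" by (simp add: h_def E zero)
  finally have "E x \<le> 0" by (simp add: h_def mult_le_0_iff)
  hence "(norm (f x))\<^sup>2 \<le> 0" unfolding E by (smt (verit) zero_le_power2)
  thus ?thesis by simp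
qed

text \<open>The usual argument multiplies the equation by \<open>cnj X\<close> and integrates by
  parts. Here the boundary term \<open>W\<close> itself is followed instead of an integral: it
  vanishes at both ends, so a fixed sign of the real or imaginary part of \<open>W'\<close> forces
  that part to be zero.\<close>

lemma weighted_string_eigenvalue_pos:
  fixes X X' :: "real \<Rightarrow> complex"
  assumes cX: "continuous_on {0..1} X" and cX': "continuous_on {0..1} X'"
    and bdry: "X 0 = 0" "X 1 = 0"
    and D: "\<And>x. 0 < x \<Longrightarrow> x < 1 \<Longrightarrow> (X has_vector_derivative X' x) (at x)"
      "\<And>x. 0 < x \<Longrightarrow> x < 1 \<Longrightarrow> (X' has_vector_derivative - \<mu> * of_real (x powr n) * X x) (at x)"
    and nz: "0 < x0" "x0 < 1" "X x0 \<noteq> 0"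
  shows "Im \<mu> = 0" "Re \<mu> > 0"
proof -
  define W W' where "W x = X' x * cnj (X x)"
    and "W' x = X' x * cnj (X' x) + - \<mu> * of_real (x powr n) * X x * cnj (X x)" for x
  have DW: "(W has_vector_derivative W' x) (at x)" if "0 < x" "x < 1" for x
    unfolding W_def[abs_def] W'_def by (intro has_vector_derivative_mult_cnj D that)
  have cW: "continuous_on {0..1} W"
    unfolding W_def[abs_def] by (intro continuous_intros cX cX')
  have W0: "W 0 = 0" "W 1 = 0" by (simp_all add: W_def bdry)
  have ImW': "Im (W' x) = - Im \<mu> * x powr n * (norm (X x))\<^sup>2" for x
    unfolding W'_def cmod_power2 by (simp add: power2_eq_square algebra_simps)
  have ReW': "Re (W' x) = (norm (X' x))\<^sup>2 - Re \<mu> * x powr n * (norm (X x))\<^sup>2" for x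
    unfolding W'_def cmod_power2 by (simp add: power2_eq_square algebra_simps)
  have pos: "x0 powr n * (norm (X x0))\<^sup>2 > 0" using nz by simp
  show "Im \<mu> = 0"
  proof -
    \<comment> \<open>This sign makes the derivative of \<open>s * Im W\<close> equal to
      \<open>\<bar>Im \<mu>\<bar>\<close> times a nonnegative weight, which treats both signs of
      \<open>Im \<mu>\<close> at once.\<close>
    define s where "s = - sgn (Im \<mu>)"
    have "s * Im (W' x0) = 0"
    proof (rule nonneg_derivative_eq_zero[where f = "\<lambda>x. s * Im (W x)" and f' = "\<lambda>x. s * Im (W' x)"])
      fix x :: real assume x: "0 < x" "x < 1"
      show "((\<lambda>x. s * Im (W x)) has_real_derivative s * Im (W' x)) (at x)"
        by (intro DERIV_cmult has_real_derivative_Im DW x)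
      have "s * Im (W' x) = \<bar>Im \<mu>\<bar> * x powr n * (norm (X x))\<^sup>2"
        unfolding ImW' s_def by (simp add: abs_sgn mult_ac)
      thus "0 \<le> s * Im (W' x)" by simp
    qed (use nz W0 cW in \<open>auto intro!: continuous_intros\<close>)
    thus ?thesis using pos unfolding ImW' s_def by (auto simp: sgn_zero_iff)
  qed
  show "Re \<mu> > 0"
  proof (rule ccontr)
    assume "\<not> Re \<mu> > 0"
    hence le: "Re \<mu> \<le> 0" by simp
    \<comment> \<open>For \<open>Re \<mu> \<le> 0\<close> both summands of \<open>Re (W' x)\<close>
      are nonnegative, so each of them vanishes. Then \<open>X' = 0\<close>, and \<open>X\<close>
      would be constantly \<open>X 0 = 0\<close>, against \<open>X x0 \<noteq> 0\<close>.\<close>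
    have zero: "Re (W' x) = 0" if "0 < x" "x < 1" for x
    proof (rule nonneg_derivative_eq_zero[where f = "\<lambda>x. Re (W x)" and f' = "\<lambda>x. Re (W' x)"])
      fix x :: real assume x: "0 < x" "x < 1"
      show "((\<lambda>x. Re (W x)) has_real_derivative Re (W' x)) (at x)"
        by (intro has_real_derivative_Re DW x)
      have "Re \<mu> * (x powr n * (norm (X x))\<^sup>2) \<le> 0" using le by (simp add: mult_nonpos_nonneg)
      thus "0 \<le> Re (W' x)" unfolding ReW' mult.assoc
        by (smt (verit) zero_le_power2)
    qed (use that W0 cW in \<open>auto intro!: continuous_intros\<close>)
    have X'0: "X' x = 0" if "0 < x" "x < 1" for x
    proof -
      have "Re \<mu> * (x powr n * (norm (X x))\<^sup>2) \<le> 0" using le by (simp add: mult_nonpos_nonneg)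
      hence "(norm (X' x))\<^sup>2 \<le> 0" using zero[OF that] unfolding ReW' by (simp add: mult.assoc)
      thus ?thesis by simp
    qed
    have "X x0 = X 0"
    proof (rule has_derivative_zero_unique_strong_interval[where k = "{0,1}" and f = X and a = 0 and b = 1])
      fix x :: real assume "x \<in> {0..1} - {0, 1}"
      hence x: "0 < x" "x < 1" by auto
      show "(X has_derivative (\<lambda>h. 0)) (at x within {0..1})"
        using D(1)[OF x] X'0[OF x] by (auto simp: has_vector_derivative_def intro: has_derivative_at_withinI)
    qed (use nz cX in auto)
    thus False using nz bdry by simp
  qed
qed

text \<open>Once the eigenvalue is known to be real and positive, the multiple of
  \<open>profile\<close> with the same slope at 0 has the same Cauchy data there as
  \<open>X\<close>, so \<open>weighted_string_unique\<close> identifies the two. The condition at 1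
  is then the eigenvalue equation.\<close>

lemma weighted_string_dirichlet:
  fixes X X' :: "real \<Rightarrow> complex"
  assumes n: "n > 0"
    and cX: "continuous_on {0..1} X" and bdry: "X 0 = 0" "X 1 = 0"
    and D: "\<And>x. 0 < x \<Longrightarrow> x < 1 \<Longrightarrow> (X has_vector_derivative X' x) (at x)"
      "\<And>x. 0 < x \<Longrightarrow> x < 1 \<Longrightarrow> (X' has_vector_derivative - \<mu> * of_real (x powr n) * X x) (at x)"
    and nz: "0 < x0" "x0 < 1" "X x0 \<noteq> 0"
  obtains \<omega> A where "\<omega> > 0" "\<mu> = of_real \<omega>" "A \<noteq> 0"
    "\<And>x. x \<in> {0..1} \<Longrightarrow> X x = A * of_real (profile n (\<omega> / (n + 2)\<^sup>2) x)"
    "profile n (\<omega> / (n + 2)\<^sup>2) 1 = 0"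
proof -
  have "compact (X ` {0..1})" by (intro compact_continuous_image cX) auto
  then obtain M where M: "\<And>x. x \<in> {0..1} \<Longrightarrow> norm (X x) \<le> M"
    by (metis bounded_iff compact_imp_bounded imageI)
  have B: "norm (- \<mu> * of_real (x powr n) * X x) \<le> norm \<mu> * M" if x: "0 < x" "x < 1" for x
  proof -
    have "x powr n \<le> 1" using x n by (simp add: powr_le1)
    have "norm (- \<mu> * of_real (x powr n) * X x) = norm \<mu> * (x powr n * norm (X x))"
      by (simp add: norm_mult)
    also have "\<dots> \<le> norm \<mu> * (1 * M)"
      using M[of x] x \<open>x powr n \<le> 1\<close> by (intro mult_left_mono mult_mono) auto
    finally show ?thesis by simp
  qed
  \<comment> \<open>\<open>X''\<close> is bounded, so \<open>X'\<close> extends continuously to the end points.\<close>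
  obtain Y where cY: "continuous_on {0..1} Y" and Y: "\<And>x. 0 < x \<Longrightarrow> x < 1 \<Longrightarrow> Y x = X' x"
  proof (rule extend_bounded_derivative[where f = X'])
    show "(X' has_vector_derivative - \<mu> * of_real (x powr n) * X x) (at x)"
      if "0 < x" "x < 1" for x by (rule D(2)[OF that])
    show "norm (- \<mu> * of_real (x powr n) * X x) \<le> norm \<mu> * M"
      if "0 < x" "x < 1" for x by (rule B[OF that])
    show thesis if "continuous_on {0..1} g" "\<And>x. 0 < x \<Longrightarrow> x < 1 \<Longrightarrow> g x = X' x" for g
      by (rule \<open>\<And>Y. continuous_on {0..1} Y \<Longrightarrow> (\<And>x. 0 < x \<Longrightarrow> x < 1 \<Longrightarrow> Y x = X' x) \<Longrightarrow> thesis\<close>[OF that])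
  qed
  have DX: "(X has_vector_derivative Y x) (at x)" if "0 < x" "x < 1" for x
    using D(1)[OF that] Y[OF that] by simp
  have DY: "(Y has_vector_derivative - \<mu> * of_real (x powr n) * X x) (at x)" if "0 < x" "x < 1" for x
    using that
    by (intro has_vector_derivative_transform_within_open[OF D(2)[OF that], of "{0<..<1}"]) (auto simp: Y)
  have mu: "Im \<mu> = 0" "Re \<mu> > 0"
    by (rule weighted_string_eigenvalue_pos[OF cX cY bdry DX DY nz]; assumption)+
  define \<omega> where "\<omega> = Re \<mu>"
  have \<mu>: "\<mu> = of_real \<omega>" using mu by (simp add: complex_eq_iff \<omega>_def)
  \<comment> \<open>Chosen so that the factor \<open>(n + 2)\<^sup>2 * c\<close> in the equation for
    \<open>profile\<close> is the eigenvalue.\<close>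
  define c where "c = \<omega> / (n + 2)\<^sup>2"
  have c: "(n + 2)\<^sup>2 * c = \<omega>" using n by (simp add: c_def)
  \<comment> \<open>Matches the slopes at 0; the division is legitimate because the slope of the
    profile there is positive.\<close>
  define A where "A = Y 0 / of_real (profile' n c 0)"
  have Y0: "Y 0 = A * of_real (profile' n c 0)"
    using profile'_0_pos[OF n, of c] by (simp add: A_def)
  have X: "X x = A * of_real (profile n c x)" if x: "x \<in> {0..1}" for x
  proof -
    have "X x - A * of_real (profile n c x) = 0"
    proof (rule weighted_string_unique[where n = n and \<omega> = \<omega>
          and f = "\<lambda>x. X x - A * of_real (profile n c x)"
          and g = "\<lambda>x. Y x - A * of_real (profile' n c x)"])
      show "continuous_on {0..1} (\<lambda>x. X x - A * of_real (profile n c x))"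
        by (intro continuous_intros cX continuous_on_subset[OF continuous_on_profile] n) auto
      show "continuous_on {0..1} (\<lambda>x. Y x - A * of_real (profile' n c x))"
        by (intro continuous_intros cY continuous_on_subset[OF continuous_on_profile'] n) auto
      fix x :: real assume x: "0 < x" "x < 1"
      show "((\<lambda>x. X x - A * of_real (profile n c x)) has_vector_derivative
          Y x - A * of_real (profile' n c x)) (at x)"
        using DERIV_profile[OF n x(1), of c]
        by (intro has_vector_derivative_diff DX x has_vector_derivative_mult_right has_vector_derivative_of_real)
      have "((\<lambda>x. Y x - A * of_real (profile' n c x)) has_vector_derivative
          - \<mu> * of_real (x powr n) * X x - A * of_real (- ((n + 2)\<^sup>2 * c * x powr n * profile n c x))) (at x)"
        using DERIV_profile'[OF n x(1), of c]
        by (intro has_vector_derivative_diff DY x has_vector_derivative_mult_right has_vector_derivative_of_real)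
      thus "((\<lambda>x. Y x - A * of_real (profile' n c x)) has_vector_derivative
          - of_real (\<omega> * x powr n) * (X x - A * of_real (profile n c x))) (at x)"
        unfolding c \<mu> by (simp add: algebra_simps)
    qed (use n mu x bdry Y0 in \<open>auto simp: \<omega>_def profile_def\<close>)
    thus ?thesis by simp
  qed
  have "A \<noteq> 0" using X[of x0] nz by auto
  moreover from this have "profile n c 1 = 0" using X[of 1] bdry by simp
  moreover have "\<omega> > 0" using mu by (simp add: \<omega>_def)
  ultimately show thesis
    using \<mu> X unfolding c_def by (intro that[of \<omega> A])
qed

section \<open>The non-local problem in time\<close>

lemma has_vector_derivative_exp_powr:
  assumes "t > 0" "k > 0"
  shows "((\<lambda>t. exp (c * of_real (t powr (k + 1))) :: complex) has_vector_derivative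
    c * of_real ((k + 1) * t powr k) * exp (c * of_real (t powr (k + 1)))) (at t)"
proof -
  have "((\<lambda>t. t powr (k + 1)) has_real_derivative (k + 1) * t powr k) (at t)"
    using assms by (auto intro!: derivative_eq_intros)
  hence "((\<lambda>t. c * of_real (t powr (k + 1))) has_vector_derivative c * of_real ((k + 1) * t powr k)) (at t)"
    by (intro has_vector_derivative_mult_right has_vector_derivative_of_real)
  from field_vector_diff_chain_at[OF this DERIV_exp] show ?thesis
    by (simp add: o_def)
qed

lemma continuous_on_exp_powr:
  "k > 0 \<Longrightarrow> continuous_on {0..1} (\<lambda>t::real. exp (c * of_real (t powr (k + 1))) :: complex)"
  by (intro continuous_intros continuous_on_subset[OF continuous_on_powr_nonneg]) auto

lemma complex_of_real_add_one_nonzero: "k > 0 \<Longrightarrow> complex_of_real (k + 1) \<noteq> 0"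
  by (metis add_pos_pos less_irrefl of_real_eq_0_iff zero_less_one)

text \<open>Multiplication by the integrating factor \<open>exp (c * t powr (k + 1))\<close> gives a
  function with derivative 0 inside the interval and continuous up to its ends, hence
  constant.\<close>

lemma time_ode_unique:
  fixes T :: "real \<Rightarrow> complex"
  assumes k: "k > 0" and cT: "continuous_on {0..1} T"
    and D: "\<And>t. 0 < t \<Longrightarrow> t < 1 \<Longrightarrow> (T has_vector_derivative - (\<kappa> * of_real (t powr k) * T t)) (at t)"
    and t: "t \<in> {0..1}"
  shows "T t = T 0 * exp (- (\<kappa> / of_real (k + 1)) * of_real (t powr (k + 1)))"
proof -
  define c where "c = \<kappa> / of_real (k + 1)"
  have \<kappa>: "\<kappa> = c * of_real (k + 1)"
    unfolding c_def by (rule nonzero_eq_divide_eq[THEN iffD1, OF complex_of_real_add_one_nonzero[OF k] refl, symmetric])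
  define H where "H t = T t * exp (c * of_real (t powr (k + 1)))" for t
  have "H t = T 0"
  proof (rule has_derivative_zero_unique_strong_interval[where k = "{0,1}" and f = H and a = 0 and b = 1])
    show "continuous_on {0..1} H"
      unfolding H_def[abs_def] by (intro continuous_on_mult cT continuous_on_exp_powr k)
    fix t :: real assume "t \<in> {0..1} - {0, 1}"
    hence t: "0 < t" "t < 1" by auto
    have "(H has_vector_derivative T t * (c * of_real ((k + 1) * t powr k) * exp (c * of_real (t powr (k + 1))))
        + - (\<kappa> * of_real (t powr k) * T t) * exp (c * of_real (t powr (k + 1)))) (at t)"
      unfolding H_def[abs_def]
      by (intro has_vector_derivative_mult D t has_vector_derivative_exp_powr k)
    moreover have "T t * (c * of_real ((k + 1) * t powr k) * exp (c * of_real (t powr (k + 1))))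
        + - (\<kappa> * of_real (t powr k) * T t) * exp (c * of_real (t powr (k + 1))) = 0"
      unfolding \<kappa> by (simp add: algebra_simps)
    ultimately have "(H has_vector_derivative 0) (at t)" by (simp only:)
    thus "(H has_derivative (\<lambda>h. 0)) (at t within {0..1})"
      by (auto simp: has_vector_derivative_def intro: has_derivative_at_withinI)
  qed (use t in \<open>auto simp: H_def\<close>)
  thus ?thesis unfolding H_def c_def[symmetric]
    by (simp add: exp_minus field_simps)
qed

text \<open>Every solution is \<open>T 0\<close> times an exponential, so the non-local condition
  reduces to a scalar equation between \<alpha> and the value of that exponential at 1. It decides
  which \<open>lam\<close> are eigenvalues, and the constant remains free.\<close>

lemma T_problem_iff:
  fixes T :: "real \<Rightarrow> complex"
  assumes k: "k > 0"
  defines "c \<equiv> \<lambda>lam \<mu>. (lam + of_real \<mu>) / of_real (k + 1)"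
  shows "T_problem k \<alpha> lam \<mu> T \<and> (\<exists>t\<in>{0..1}. T t \<noteq> 0) \<longleftrightarrow>
    exp (c lam \<mu>) = \<alpha> \<and>
    (\<exists>C. C \<noteq> 0 \<and> (\<forall>t\<in>{0..1}. T t = C * exp (- c lam \<mu> * of_real (t powr (k + 1)))))"
    (is "?L \<longleftrightarrow> ?R")
proof
  assume L: ?L
  have eq: "T t = T 0 * exp (- c lam \<mu> * of_real (t powr (k + 1)))" if t: "t \<in> {0..1}" for t
    unfolding c_def
  proof (rule time_ode_unique[OF k _ _ t])
    show "continuous_on {0..1} T" using L by (simp add: T_problem_def)
    fix t :: real assume "0 < t" "t < 1"
    hence *: "T differentiable (at t)"
      "vector_derivative T (at t) + (lam + of_real \<mu>) * of_real (t powr k) * T t = 0"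
      using L by (auto simp: T_problem_def)
    have "vector_derivative T (at t) = - ((lam + of_real \<mu>) * of_real (t powr k) * T t)"
      using *(2) by (simp only: eq_neg_iff_add_eq_0)
    thus "(T has_vector_derivative - ((lam + of_real \<mu>) * of_real (t powr k) * T t)) (at t)"
      using *(1) by (metis vector_derivative_works)
  qed
  \<comment> \<open>A non-zero value anywhere forces \<open>T 0 \<noteq> 0\<close>, so that
    \<open>T 0\<close> can be cancelled in the non-local condition.\<close>
  obtain t where "t \<in> {0..1}" "T t \<noteq> 0" using L by blast
  hence T0: "T 0 \<noteq> 0" using eq[of t] by (metis mult_zero_left)
  have "T 0 = \<alpha> * T 1" using L by (simp add: T_problem_def)
  also have "\<dots> = \<alpha> * (T 0 * exp (- c lam \<mu>))" using eq[of 1] by simp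
  finally have "\<alpha> * exp (- c lam \<mu>) = 1" using T0 by (simp add: algebra_simps)
  hence "exp (c lam \<mu>) = \<alpha>" by (simp add: exp_minus field_simps)
  thus ?R using T0 eq by blast
next
  assume R: ?R
  then obtain C where C: "C \<noteq> 0" "\<And>t. t \<in> {0..1} \<Longrightarrow> T t = C * exp (- c lam \<mu> * of_real (t powr (k + 1)))"
    by blast
  have lam: "lam + of_real \<mu> = c lam \<mu> * of_real (k + 1)"
    unfolding c_def by (rule nonzero_eq_divide_eq[THEN iffD1, OF complex_of_real_add_one_nonzero[OF k] refl, symmetric])
  have "continuous_on {0..1} (\<lambda>t. C * exp (- c lam \<mu> * of_real (t powr (k + 1))))"
    by (intro continuous_on_mult continuous_on_const continuous_on_exp_powr k)
  hence "continuous_on {0..1} T"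
    by (rule continuous_on_eq) (simp add: C)
  moreover have "T differentiable (at t) \<and>
      vector_derivative T (at t) + (lam + of_real \<mu>) * of_real (t powr k) * T t = 0"
    if t: "t \<in> {0<..<1}" for t
  proof -
    have "((\<lambda>t. C * exp (- c lam \<mu> * of_real (t powr (k + 1)))) has_vector_derivative
        C * (- c lam \<mu> * of_real ((k + 1) * t powr k) * exp (- c lam \<mu> * of_real (t powr (k + 1))))) (at t)"
      using t by (intro has_vector_derivative_mult_right has_vector_derivative_exp_powr k) auto
    \<comment> \<open>The formula for \<open>T\<close> holds only on the closed unit interval; at an
      interior point the derivative is transferred through the open interval.\<close>
    hence "(T has_vector_derivative
        C * (- c lam \<mu> * of_real ((k + 1) * t powr k) * exp (- c lam \<mu> * of_real (t powr (k + 1))))) (at t)"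
      by (rule has_vector_derivative_transform_within_open[of _ _ _ "{0<..<1}"]) (use t C in auto)
    moreover have "C * (- c lam \<mu> * of_real ((k + 1) * t powr k) * exp (- c lam \<mu> * of_real (t powr (k + 1))))
        = - ((lam + of_real \<mu>) * of_real (t powr k) * T t)"
      using C(2)[of t] t unfolding lam by simp
    ultimately have "(T has_vector_derivative - ((lam + of_real \<mu>) * of_real (t powr k) * T t)) (at t)"
      by (simp only:)
    from differentiableI_vector[OF this] vector_derivative_at[OF this] show ?thesis by simp
  qed
  moreover have "T 0 = \<alpha> * T 1"
    using C(2)[of 0] C(2)[of 1] by (simp add: exp_minus flip: conjunct1[OF R])
  moreover have "T 0 \<noteq> 0" using C(1) C(2)[of 0] by simp
  ultimately show ?L by (auto simp: T_problem_def intro!: bexI[of _ 0])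
qed

section \<open>Branches of the logarithm of \<alpha> and the real form of the non-local
  condition\<close>

lemma cos_sin_arctan_ratio:
  fixes a b :: real
  assumes "a\<^sup>2 + b\<^sup>2 \<noteq> 0"
  defines "\<sigma> \<equiv> (if a < 0 then - 1 else 1)"
  shows "cos (arctan_ratio b a) = \<sigma> * a / sqrt (a\<^sup>2 + b\<^sup>2)"
    and "sin (arctan_ratio b a) = \<sigma> * b / sqrt (a\<^sup>2 + b\<^sup>2)"
proof -
  \<comment> \<open>\<open>arctan\<close> only yields angles with positive cosine, so for
    \<open>a < 0\<close> the angle belongs to the opposite point \<open>(- a, - b)\<close>; this is
    the sign \<sigma>. For \<open>a = 0\<close> the convention in \<open>arctan_ratio\<close> gives
    the direction of \<open>b\<close> itself.\<close>
  have "cos (arctan_ratio b a) = \<sigma> * a / sqrt (a\<^sup>2 + b\<^sup>2) \<and> sin (arctan_ratio b a) = \<sigma> * b / sqrt (a\<^sup>2 + b\<^sup>2)"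
  proof (cases "a = 0")
    case True
    hence "b \<noteq> 0" using assms by auto
    thus ?thesis using True by (cases "b > 0") (auto simp: arctan_ratio_def \<sigma>_def sgn_if)
  next
    case False
    have "1 + (b / a)\<^sup>2 = (a\<^sup>2 + b\<^sup>2) / a\<^sup>2" using False by (simp add: field_simps)
    hence "sqrt (1 + (b / a)\<^sup>2) = sqrt (a\<^sup>2 + b\<^sup>2) / \<bar>a\<bar>" by (simp add: real_sqrt_divide)
    thus ?thesis using False by (auto simp: arctan_ratio_def \<sigma>_def cos_arctan sin_arctan)
  qed
  thus "cos (arctan_ratio b a) = \<sigma> * a / sqrt (a\<^sup>2 + b\<^sup>2)"
    "sin (arctan_ratio b a) = \<sigma> * b / sqrt (a\<^sup>2 + b\<^sup>2)" by auto
qed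

text \<open>Adding \<open>s * pi\<close> multiplies cosine and sine by the parity sign of
  \<open>s\<close>; admissibility is precisely the parity that cancels the sign left by
  \<open>arctan_ratio\<close>.\<close>

lemma cos_sin_admissible:
  assumes r: "\<alpha>1\<^sup>2 + \<alpha>2\<^sup>2 \<noteq> 0" and s: "s \<in> admissible \<alpha>1"
  shows "cos (arctan_ratio \<alpha>2 \<alpha>1 + of_int s * pi) = \<alpha>1 / sqrt (\<alpha>1\<^sup>2 + \<alpha>2\<^sup>2)"
    and "sin (arctan_ratio \<alpha>2 \<alpha>1 + of_int s * pi) = \<alpha>2 / sqrt (\<alpha>1\<^sup>2 + \<alpha>2\<^sup>2)"
proof -
  have cs: "cos (of_int s * pi) = (if \<alpha>1 < 0 then - 1 else 1)" "sin (of_int s * pi) = 0"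
    using s by (auto simp: admissible_def cos_npi_int sin_npi_int mult.commute[of _ pi])
  show "cos (arctan_ratio \<alpha>2 \<alpha>1 + of_int s * pi) = \<alpha>1 / sqrt (\<alpha>1\<^sup>2 + \<alpha>2\<^sup>2)"
    "sin (arctan_ratio \<alpha>2 \<alpha>1 + of_int s * pi) = \<alpha>2 / sqrt (\<alpha>1\<^sup>2 + \<alpha>2\<^sup>2)"
    using cos_sin_arctan_ratio[OF r] by (simp_all add: cos_add sin_add cs)
qed

text \<open>The logarithm of \<open>\<alpha>1 + \<i> \<alpha>2\<close> on the branch numbered \<open>s\<close>, provided \<open>s\<close> is admissible.\<close>

definition log_alpha :: "real \<Rightarrow> real \<Rightarrow> int \<Rightarrow> complex" where
  "log_alpha \<alpha>1 \<alpha>2 s = Complex (ln (sqrt (\<alpha>1\<^sup>2 + \<alpha>2\<^sup>2))) (arctan_ratio \<alpha>2 \<alpha>1 + of_int s * pi)"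

lemma sum_squares_pos: "(a::real)\<^sup>2 + b\<^sup>2 \<noteq> 0 \<Longrightarrow> a\<^sup>2 + b\<^sup>2 > 0"
  by (smt (verit) zero_le_power2)

lemma exp_log_alpha:
  assumes r: "\<alpha>1\<^sup>2 + \<alpha>2\<^sup>2 \<noteq> 0" and s: "s \<in> admissible \<alpha>1"
  shows "exp (log_alpha \<alpha>1 \<alpha>2 s) = Complex \<alpha>1 \<alpha>2"
proof -
  have "sqrt (\<alpha>1\<^sup>2 + \<alpha>2\<^sup>2) > 0" using sum_squares_pos[OF r] by simp
  thus ?thesis
    unfolding log_alpha_def by (simp add: exp_eq_polar cis.ctr complex_eq_iff cos_sin_admissible[OF assms])
qed

text \<open>The summand \<open>- \<mu>\<close> in \<open>lambda1\<close> cancels the separation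
  constant, so the exponent of the time factor depends only on \<alpha> and the branch; this is why
  \<open>time_factor\<close> contains no \<mu>.\<close>

lemma lambda_eq_log_alpha:
  assumes r: "\<alpha>1\<^sup>2 + \<alpha>2\<^sup>2 \<noteq> 0" and k: "k > 0"
  shows "(Complex (lambda1 k \<alpha>1 \<alpha>2 \<mu>) (lambda2 k \<alpha>1 \<alpha>2 s) + of_real \<mu>) / of_real (k + 1)
    = log_alpha \<alpha>1 \<alpha>2 s"
proof -
  have "k + 1 \<noteq> 0" using k by simp
  have "Complex (lambda1 k \<alpha>1 \<alpha>2 \<mu>) (lambda2 k \<alpha>1 \<alpha>2 s) + of_real \<mu>
      = log_alpha \<alpha>1 \<alpha>2 s * of_real (k + 1)"
    using sum_squares_pos[OF r]
    by (simp add: complex_eq_iff log_alpha_def lambda1_def lambda2_def ln_sqrt algebra_simps)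
  thus ?thesis by (rule nonzero_divide_eq_eq[THEN iffD2, OF complex_of_real_add_one_nonzero[OF k]])
qed

lemma time_factor_eq:
  "time_factor k \<alpha>1 \<alpha>2 s t = exp (- log_alpha \<alpha>1 \<alpha>2 s * of_real (t powr (k + 1)))"
proof -
  have "- of_real (ln (sqrt (\<alpha>1\<^sup>2 + \<alpha>2\<^sup>2))) - \<i> * of_real (arctan_ratio \<alpha>2 \<alpha>1 + of_int s * pi)
      = - log_alpha \<alpha>1 \<alpha>2 s"
    by (simp add: complex_eq_iff log_alpha_def)
  thus ?thesis unfolding time_factor_def by (simp only:)
qed

text \<open>If \<alpha> is the exponential of \<open>a + \<i> b\<close>, then its squared modulus is
  \<open>(exp a)\<^sup>2\<close>, and dividing by that replaces \<open>exp a\<close> by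
  \<open>exp (- a)\<close> in both components.\<close>

lemma exp_eq_alpha_imp:
  assumes k: "k > 0"
    and e: "exp ((Complex lam1 lam2 + of_real \<mu>) / of_real (k + 1)) = Complex \<alpha>1 \<alpha>2"
  shows "\<alpha>1 / (\<alpha>1\<^sup>2 + \<alpha>2\<^sup>2) = exp (- (lam1 + \<mu>) / (k + 1)) * cos (lam2 / (k + 1))"
    and "\<alpha>2 / (\<alpha>1\<^sup>2 + \<alpha>2\<^sup>2) = exp (- (lam1 + \<mu>) / (k + 1)) * sin (lam2 / (k + 1))"
proof -
  define a b where "a = (lam1 + \<mu>) / (k + 1)" and "b = lam2 / (k + 1)"
  have "(Complex lam1 lam2 + of_real \<mu>) / of_real (k + 1) = Complex a b"
    unfolding complex_eq_iff Re_divide_of_real Im_divide_of_real by (simp add: a_def b_def)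
  with e have "exp (Complex a b) = Complex \<alpha>1 \<alpha>2" by simp
  hence \<alpha>: "\<alpha>1 = exp a * cos b" "\<alpha>2 = exp a * sin b"
    by (simp_all add: exp_eq_polar complex_eq_iff)
  have "\<alpha>1\<^sup>2 + \<alpha>2\<^sup>2 = (exp a)\<^sup>2 * ((cos b)\<^sup>2 + (sin b)\<^sup>2)"
    unfolding \<alpha> by (simp only: power_mult_distrib distrib_left)
  hence r: "\<alpha>1\<^sup>2 + \<alpha>2\<^sup>2 = (exp a)\<^sup>2" by simp
  have "- (lam1 + \<mu>) / (k + 1) = - a" by (simp only: a_def minus_divide_left)
  thus "\<alpha>1 / (\<alpha>1\<^sup>2 + \<alpha>2\<^sup>2) = exp (- (lam1 + \<mu>) / (k + 1)) * cos (lam2 / (k + 1))"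
    "\<alpha>2 / (\<alpha>1\<^sup>2 + \<alpha>2\<^sup>2) = exp (- (lam1 + \<mu>) / (k + 1)) * sin (lam2 / (k + 1))"
    unfolding r b_def[symmetric] using \<alpha> by (simp_all add: exp_minus power2_eq_square divide_inverse)
qed

text \<open>The two real equations are a polar form of \<alpha>: the modulus fixes
  \<open>lam1\<close>, the angle fixes \<open>lam2\<close> up to multiples of the full turn, and
  full turns are the steps of size 2 within one parity class of \<open>s\<close>.\<close>

lemma nonlocal_equations_iff:
  assumes r: "\<alpha>1\<^sup>2 + \<alpha>2\<^sup>2 \<noteq> 0" and k: "k > 0"
  shows "\<alpha>1 / (\<alpha>1\<^sup>2 + \<alpha>2\<^sup>2) = exp (- (lam1 + \<mu>) / (k + 1)) * cos (lam2 / (k + 1)) \<and>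
     \<alpha>2 / (\<alpha>1\<^sup>2 + \<alpha>2\<^sup>2) = exp (- (lam1 + \<mu>) / (k + 1)) * sin (lam2 / (k + 1)) \<longleftrightarrow>
     lam1 = lambda1 k \<alpha>1 \<alpha>2 \<mu> \<and> (\<exists>s\<in>admissible \<alpha>1. lam2 = lambda2 k \<alpha>1 \<alpha>2 s)"
    (is "?L \<longleftrightarrow> ?R")
proof
  assume ?R
  then obtain s where s: "s \<in> admissible \<alpha>1" and lam: "lam1 = lambda1 k \<alpha>1 \<alpha>2 \<mu>" "lam2 = lambda2 k \<alpha>1 \<alpha>2 s"
    by blast
  have "exp ((Complex lam1 lam2 + of_real \<mu>) / of_real (k + 1)) = Complex \<alpha>1 \<alpha>2"
    unfolding lam lambda_eq_log_alpha[OF r k] by (rule exp_log_alpha[OF r s])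
  thus ?L using exp_eq_alpha_imp[OF k] by blast
next
  assume L: ?L
  define R where "R = \<alpha>1\<^sup>2 + \<alpha>2\<^sup>2"
  define a b where "a = (lam1 + \<mu>) / (k + 1)" and "b = lam2 / (k + 1)"
  have R: "R > 0" using sum_squares_pos[OF r] by (simp add: R_def)
  have "- (lam1 + \<mu>) / (k + 1) = - a" by (simp only: a_def minus_divide_left)
  hence ab: "\<alpha>1 / R = exp (- a) * cos b" "\<alpha>2 / R = exp (- a) * sin b"
    using L by (simp_all only: R_def b_def)
  \<comment> \<open>Squaring and adding removes the angle and leaves an equation for the modulus
    alone.\<close>
  have "(\<alpha>1 / R)\<^sup>2 + (\<alpha>2 / R)\<^sup>2 = (exp (- a))\<^sup>2 * ((cos b)\<^sup>2 + (sin b)\<^sup>2)"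
    unfolding ab by (simp only: power_mult_distrib distrib_left)
  moreover have "(\<alpha>1 / R)\<^sup>2 + (\<alpha>2 / R)\<^sup>2 = inverse R"
  proof -
    have "(\<alpha>1 / R)\<^sup>2 + (\<alpha>2 / R)\<^sup>2 = R / R\<^sup>2"
      unfolding power_divide add_divide_distrib[symmetric] by (simp only: R_def)
    thus ?thesis using R by (simp add: power2_eq_square inverse_eq_divide)
  qed
  ultimately have "inverse R = inverse ((exp a)\<^sup>2)"
    by (simp add: exp_minus power_inverse)
  hence "R = (exp a)\<^sup>2" by (rule inverse_eq_imp_eq)
  hence sq: "sqrt R = exp a" by simp
  have "ln R = 2 * a" using \<open>R = (exp a)\<^sup>2\<close> by (simp add: ln_realpow)
  hence lam1: "lam1 = lambda1 k \<alpha>1 \<alpha>2 \<mu>"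
  proof -
    have "(k + 1) * a = lam1 + \<mu>" using k by (simp add: a_def)
    moreover have "lambda1 k \<alpha>1 \<alpha>2 \<mu> = - \<mu> + (k + 1) * a"
      using \<open>ln R = 2 * a\<close> by (simp add: lambda1_def flip: R_def)
    ultimately show ?thesis by simp
  qed
  have cs: "cos b = \<alpha>1 / sqrt R" "sin b = \<alpha>2 / sqrt R"
  proof -
    have RR: "R = exp a * exp a" using \<open>R = (exp a)\<^sup>2\<close> by (simp add: power2_eq_square)
    show "cos b = \<alpha>1 / sqrt R" "sin b = \<alpha>2 / sqrt R"
      using ab unfolding sq unfolding RR by (simp_all add: exp_minus field_simps)
  qed
  \<comment> \<open>One representative of the admissible parity; the multiple of
    \<open>2 * pi\<close> obtained next is absorbed as \<open>s0 + 2 * j\<close>.\<close>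
  define s0 :: int where "s0 = (if 0 \<le> \<alpha>1 then 0 else 1)"
  have s0: "s0 \<in> admissible \<alpha>1" by (simp add: s0_def admissible_def)
  obtain j :: int where "b = arctan_ratio \<alpha>2 \<alpha>1 + of_int s0 * pi + 2 * pi * of_int j"
    using sin_cos_eq_iff[of b "arctan_ratio \<alpha>2 \<alpha>1 + of_int s0 * pi"] cs cos_sin_admissible[OF r s0]
    by (auto simp: R_def)
  hence "b = arctan_ratio \<alpha>2 \<alpha>1 + of_int (s0 + 2 * j) * pi" by (simp add: algebra_simps)
  hence "lam2 = lambda2 k \<alpha>1 \<alpha>2 (s0 + 2 * j)"
    using k by (simp add: b_def lambda2_def field_simps)
  moreover have "s0 + 2 * j \<in> admissible \<alpha>1" using s0 by (simp add: admissible_def)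
  ultimately show ?R using lam1 by blast
qed

section \<open>Separated solutions\<close>

lemma separated_slice:
  fixes X :: "real \<Rightarrow> complex"
  assumes "(X has_vector_derivative D) (at x)" "0 < x" "x < 1"
    and "\<And>\<xi>. 0 < \<xi> \<Longrightarrow> \<xi> < 1 \<Longrightarrow> f \<xi> = X \<xi> * c"
  shows "(f has_vector_derivative D * c) (at x)"
proof -
  have "((\<lambda>\<xi>. X \<xi> * c) has_vector_derivative D * c) (at x)"
    by (intro has_vector_derivative_mult_left assms)
  thus ?thesis
    by (rule has_vector_derivative_transform_within_open[of _ _ _ "{0<..<1}"]) (use assms in auto)
qed

lemma closure_Omega: "closure Omega = {0..1} \<times> {0..1} \<times> {0..1}"
  by (simp add: Omega_def closure_Times)

text \<open>The derivatives of the factors are parameters and no equation is imposed on them. Thus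
  the same formulas serve in both directions: to verify the Bessel solutions, and to read ordinary
  differential equations off a given separated solution.\<close>

locale separated =
  fixes u :: "real \<times> real \<times> real \<Rightarrow> complex"
    and X X' X'' Y Y' Y'' T T' :: "real \<Rightarrow> complex"
  assumes u: "\<And>x y t. (x, y, t) \<in> Omega \<Longrightarrow> u (x, y, t) = X x * Y y * T t"
    and X: "\<And>x. 0 < x \<Longrightarrow> x < 1 \<Longrightarrow> (X has_vector_derivative X' x) (at x)"
      "\<And>x. 0 < x \<Longrightarrow> x < 1 \<Longrightarrow> (X' has_vector_derivative X'' x) (at x)"
    and Y: "\<And>y. 0 < y \<Longrightarrow> y < 1 \<Longrightarrow> (Y has_vector_derivative Y' y) (at y)"
      "\<And>y. 0 < y \<Longrightarrow> y < 1 \<Longrightarrow> (Y' has_vector_derivative Y'' y) (at y)"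
    and T: "\<And>t. 0 < t \<Longrightarrow> t < 1 \<Longrightarrow> (T has_vector_derivative T' t) (at t)"
begin

lemma slice_x:
  assumes "(x, y, t) \<in> Omega"
  shows "((\<lambda>\<xi>. u (\<xi>, y, t)) has_vector_derivative X' x * (Y y * T t)) (at x)"
  by (rule separated_slice[OF X(1)]) (use assms in \<open>auto simp: Omega_def intro: u[unfolded Omega_def, simplified, THEN trans]\<close>)

lemma slice_y:
  assumes "(x, y, t) \<in> Omega"
  shows "((\<lambda>\<eta>. u (x, \<eta>, t)) has_vector_derivative Y' y * (X x * T t)) (at y)"
  by (rule separated_slice[OF Y(1)]) (use assms in \<open>auto simp: Omega_def intro: u[unfolded Omega_def, simplified, THEN trans]\<close>)

lemma slice_t:
  assumes "(x, y, t) \<in> Omega"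
  shows "((\<lambda>\<tau>. u (x, y, \<tau>)) has_vector_derivative T' t * (X x * Y y)) (at t)"
  by (rule separated_slice[OF T]) (use assms in \<open>auto simp: Omega_def intro: u[unfolded Omega_def, simplified, THEN trans]\<close>)

lemma d_x: "(x, y, t) \<in> Omega \<Longrightarrow> d_x u (x, y, t) = X' x * (Y y * T t)"
  and d_y: "(x, y, t) \<in> Omega \<Longrightarrow> d_y u (x, y, t) = Y' y * (X x * T t)"
  and d_t: "(x, y, t) \<in> Omega \<Longrightarrow> d_t u (x, y, t) = T' t * (X x * Y y)"
  by (simp_all add: d_x_def d_y_def d_t_def vector_derivative_at[OF slice_x]
      vector_derivative_at[OF slice_y] vector_derivative_at[OF slice_t])

lemma slice_xx:
  assumes "(x, y, t) \<in> Omega"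
  shows "((\<lambda>\<xi>. d_x u (\<xi>, y, t)) has_vector_derivative X'' x * (Y y * T t)) (at x)"
  by (rule separated_slice[OF X(2)]) (use assms in \<open>auto simp: Omega_def intro!: d_x\<close>)

lemma slice_yy:
  assumes "(x, y, t) \<in> Omega"
  shows "((\<lambda>\<eta>. d_y u (x, \<eta>, t)) has_vector_derivative Y'' y * (X x * T t)) (at y)"
  by (rule separated_slice[OF Y(2)]) (use assms in \<open>auto simp: Omega_def intro!: d_y\<close>)

lemma d_xx: "(x, y, t) \<in> Omega \<Longrightarrow> d_x (d_x u) (x, y, t) = X'' x * (Y y * T t)"
  and d_yy: "(x, y, t) \<in> Omega \<Longrightarrow> d_y (d_y u) (x, y, t) = Y'' y * (X x * T t)"
  by (simp_all add: d_x_def[of "d_x u"] d_y_def[of "d_y u"] vector_derivative_at[OF slice_xx]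
      vector_derivative_at[OF slice_yy])

text \<open>Differentiability already makes the factors and the first derivatives \<open>X'\<close>,
  \<open>Y'\<close> continuous, so only the highest derivatives need a hypothesis; joint continuity
  follows by composing with the coordinate projections.\<close>

lemma C221:
  assumes cont: "continuous_on {0<..<1} X''" "continuous_on {0<..<1} Y''" "continuous_on {0<..<1} T'"
  shows "C221 u"
proof -
  have pull: "continuous_on Omega (\<lambda>q. f (fst q))" "continuous_on Omega (\<lambda>q. f (fst (snd q)))"
    "continuous_on Omega (\<lambda>q. f (snd (snd q)))"
    if "continuous_on {0<..<1} f" for f :: "real \<Rightarrow> complex"
    by (rule continuous_on_compose2[OF that]; force simp: Omega_def intro!: continuous_intros)+
  have deriv_cont: "continuous_on {0<..<1} f"
    if "\<And>x. 0 < x \<Longrightarrow> x < 1 \<Longrightarrow> (f has_vector_derivative f' x) (at x)" for f f' :: "real \<Rightarrow> complex"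
    using has_vector_derivative_continuous[OF that] by (intro continuous_at_imp_continuous_on) auto
  note c = deriv_cont[OF X(1)] deriv_cont[OF X(2)] deriv_cont[OF Y(1)] deriv_cont[OF Y(2)] deriv_cont[OF T]
  note [continuous_intros] = pull[OF c(1)] pull[OF c(2)] pull[OF c(3)] pull[OF c(4)] pull[OF c(5)]
    pull[OF cont(1)] pull[OF cont(2)] pull[OF cont(3)]
  have prod: "continuous_on Omega g"
    if "continuous_on Omega h" "\<And>x y t. (x, y, t) \<in> Omega \<Longrightarrow> g (x, y, t) = h (x, y, t)"
    for g h :: "real \<times> real \<times> real \<Rightarrow> complex"
    by (rule continuous_on_eq[OF that(1)]) (use that(2) in auto)
  have "continuous_on Omega u"
    by (rule prod[of "\<lambda>q. X (fst q) * Y (fst (snd q)) * T (snd (snd q))"])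
      (auto intro!: continuous_intros simp: u)
  moreover have "continuous_on Omega (d_x u)"
    by (rule prod[of "\<lambda>q. X' (fst q) * (Y (fst (snd q)) * T (snd (snd q)))"])
      (auto intro!: continuous_intros simp: d_x)
  moreover have "continuous_on Omega (d_x (d_x u))"
    by (rule prod[of "\<lambda>q. X'' (fst q) * (Y (fst (snd q)) * T (snd (snd q)))"])
      (auto intro!: continuous_intros simp: d_xx)
  moreover have "continuous_on Omega (d_y u)"
    by (rule prod[of "\<lambda>q. Y' (fst (snd q)) * (X (fst q) * T (snd (snd q)))"])
      (auto intro!: continuous_intros simp: d_y)
  moreover have "continuous_on Omega (d_y (d_y u))"
    by (rule prod[of "\<lambda>q. Y'' (fst (snd q)) * (X (fst q) * T (snd (snd q)))"])
      (auto intro!: continuous_intros simp: d_yy)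
  moreover have "continuous_on Omega (d_t u)"
    by (rule prod[of "\<lambda>q. T' (snd (snd q)) * (X (fst q) * Y (fst (snd q)))"])
      (auto intro!: continuous_intros simp: d_t)
  ultimately show ?thesis
    unfolding C221_def
    using differentiableI_vector[OF slice_x] differentiableI_vector[OF slice_xx]
      differentiableI_vector[OF slice_y] differentiableI_vector[OF slice_yy]
      differentiableI_vector[OF slice_t]
    by blast
qed

end

text \<open>All powers of 2, \<open>n + 2\<close>, \<open>m + 2\<close>, \<mu>1 and \<mu>2 in the
  explicit formula are collected in one positive constant \<open>K\<close>, independent of the
  point, of \<open>s\<close> and of \<open>D\<close>. Afterwards only products of profiles have to
  be handled.\<close>

lemma u_sol_eq:
  assumes "n > 0" "m > 0" "\<mu>1 > 0" "\<mu>2 > 0"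
  obtains K where "K > 0"
    "\<And>s D x y t. 0 \<le> x \<Longrightarrow> 0 \<le> y \<Longrightarrow> u_sol n m k \<alpha>1 \<alpha>2 \<mu>1 \<mu>2 s D (x, y, t) =
      D * of_real K * of_real (profile n (\<mu>1 / (n + 2)\<^sup>2) x) * of_real (profile m (\<mu>2 / (m + 2)\<^sup>2) y)
        * time_factor k \<alpha>1 \<alpha>2 s t"
proof -
  define z1 z2 where "z1 = 2 * sqrt \<mu>1 / (n + 2)" and "z2 = 2 * sqrt \<mu>2 / (m + 2)"
  have z: "z1 > 0" "z2 > 0" using assms by (auto simp: z1_def z2_def)
  have c: "(z1 / 2)\<^sup>2 = \<mu>1 / (n + 2)\<^sup>2" "(z2 / 2)\<^sup>2 = \<mu>2 / (m + 2)\<^sup>2"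
  proof -
    have "z1 / 2 = sqrt \<mu>1 / (n + 2)" "z2 / 2 = sqrt \<mu>2 / (m + 2)"
      using assms by (simp_all add: z1_def z2_def field_simps)
    thus "(z1 / 2)\<^sup>2 = \<mu>1 / (n + 2)\<^sup>2" "(z2 / 2)\<^sup>2 = \<mu>2 / (m + 2)\<^sup>2"
      using assms by (simp_all only: power_divide real_sqrt_pow2 less_imp_le)
  qed
  define K0 where "K0 = (2 / (n + 2)) powr (1 / (n + 2)) * (2 / (m + 2)) powr (1 / (m + 2))
        * \<mu>1 powr (1 / (2 * (n + 2))) * \<mu>2 powr (1 / (2 * (m + 2)))"
  define K where "K = K0 * ((z1 / 2) powr (1 / (n + 2)) * (z2 / 2) powr (1 / (m + 2)))"
  have "K > 0" using assms z by (simp add: K_def K0_def)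
  moreover have "u_sol n m k \<alpha>1 \<alpha>2 \<mu>1 \<mu>2 s D (x, y, t) =
      D * of_real K * of_real (profile n (\<mu>1 / (n + 2)\<^sup>2) x) * of_real (profile m (\<mu>2 / (m + 2)\<^sup>2) y)
        * time_factor k \<alpha>1 \<alpha>2 s t" if "0 \<le> x" "0 \<le> y" for s D x y t
  proof -
    have "u_sol n m k \<alpha>1 \<alpha>2 \<mu>1 \<mu>2 s D (x, y, t) =
        D * of_real (K0 * ((sqrt x * bessel_J (1 / (n + 2)) (z1 * x powr ((n + 2) / 2)))
          * (sqrt y * bessel_J (1 / (m + 2)) (z2 * y powr ((m + 2) / 2))))) * time_factor k \<alpha>1 \<alpha>2 s t"
      unfolding u_sol_def case_prod_conv z1_def[symmetric] z2_def[symmetric] K0_def real_sqrt_mult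
      by (simp add: mult_ac)
    also have "\<dots> = D * of_real K * of_real (profile n (\<mu>1 / (n + 2)\<^sup>2) x)
        * of_real (profile m (\<mu>2 / (m + 2)\<^sup>2) y) * time_factor k \<alpha>1 \<alpha>2 s t"
      unfolding sqrt_bessel_J_eq_profile[OF assms(1) z(1) that(1)]
        sqrt_bessel_J_eq_profile[OF assms(2) z(2) that(2)] c
      by (simp add: K_def mult_ac)
    finally show ?thesis .
  qed
  ultimately show thesis by (rule that)
qed

text \<open>Inserting the three ordinary differential equations turns every term of the partial
  differential equation into a multiple of \<open>t powr k * x powr n * y powr m * u\<close>, and
  the constants cancel. The profiles give the zero values on the faces, and the choice of branch
  gives the non-local condition.\<close>

lemma problem1_u_sol:
  assumes n: "n > 0" and m: "m > 0" and k: "k > 0" and r: "\<alpha>1\<^sup>2 + \<alpha>2\<^sup>2 \<noteq> 0" and s: "s \<in> admissible \<alpha>1"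
    and \<mu>: "\<mu>1 > 0" "\<mu>2 > 0"
    and zero: "profile n (\<mu>1 / (n + 2)\<^sup>2) 1 = 0" "profile m (\<mu>2 / (m + 2)\<^sup>2) 1 = 0"
  shows "problem1 n m k (Complex (lambda1 k \<alpha>1 \<alpha>2 (\<mu>1 + \<mu>2)) (lambda2 k \<alpha>1 \<alpha>2 s)) (Complex \<alpha>1 \<alpha>2)
      (u_sol n m k \<alpha>1 \<alpha>2 \<mu>1 \<mu>2 s D)" (is "problem1 n m k ?lam _ ?u")
    and "D \<noteq> 0 \<Longrightarrow> \<exists>q \<in> closure Omega. u_sol n m k \<alpha>1 \<alpha>2 \<mu>1 \<mu>2 s D q \<noteq> 0"
proof -
  define c d where "c = \<mu>1 / (n + 2)\<^sup>2" and "d = \<mu>2 / (m + 2)\<^sup>2"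
  have cd: "(n + 2)\<^sup>2 * c = \<mu>1" "(m + 2)\<^sup>2 * d = \<mu>2" using n m by (auto simp: c_def d_def)
  note zero = zero[folded c_def d_def]
  define L where "L = log_alpha \<alpha>1 \<alpha>2 s"
  have lam: "?lam + of_real (\<mu>1 + \<mu>2) = L * of_real (k + 1)"
    unfolding L_def
    by (rule nonzero_eq_divide_eq[THEN iffD1, OF complex_of_real_add_one_nonzero[OF k]
      lambda_eq_log_alpha[OF r k, symmetric], symmetric])
  obtain K where K: "K > 0" and u: "\<And>x y t. 0 \<le> x \<Longrightarrow> 0 \<le> y \<Longrightarrow> ?u (x, y, t) =
      D * of_real K * of_real (profile n c x) * of_real (profile m d y) * time_factor k \<alpha>1 \<alpha>2 s t"
    using u_sol_eq[OF n m \<mu>] unfolding c_def d_def by metis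
  define X X' X'' Y Y' Y'' T T' :: "real \<Rightarrow> complex" where
    "X = (\<lambda>x. D * of_real K * of_real (profile n c x))" and
    "X' = (\<lambda>x. D * of_real K * of_real (profile' n c x))" and
    "X'' = (\<lambda>x. D * of_real K * of_real (- ((n + 2)\<^sup>2 * c * x powr n * profile n c x)))" and
    "Y = (\<lambda>y. of_real (profile m d y))" and
    "Y' = (\<lambda>y. of_real (profile' m d y))" and
    "Y'' = (\<lambda>y. of_real (- ((m + 2)\<^sup>2 * d * y powr m * profile m d y)))" and
    "T = (\<lambda>t. exp (- L * of_real (t powr (k + 1))))" and
    "T' = (\<lambda>t. - L * of_real ((k + 1) * t powr k) * exp (- L * of_real (t powr (k + 1))))"
  have uXYT: "?u (x, y, t) = X x * Y y * T t" if "0 \<le> x" "0 \<le> y" for x y t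
    using u[OF that] by (simp only: X_def Y_def T_def L_def time_factor_eq)
  interpret separated ?u X X' X'' Y Y' Y'' T T'
  proof
    show "?u (x, y, t) = X x * Y y * T t" if "(x, y, t) \<in> Omega" for x y t
      using that by (intro uXYT) (auto simp: Omega_def)
    show "(X has_vector_derivative X' x) (at x)" if "0 < x" "x < 1" for x
      unfolding X_def X'_def
      by (intro has_vector_derivative_mult_right has_vector_derivative_of_real DERIV_profile n that)
    show "(X' has_vector_derivative X'' x) (at x)" if "0 < x" "x < 1" for x
      unfolding X'_def X''_def
      by (intro has_vector_derivative_mult_right has_vector_derivative_of_real DERIV_profile' n that)
    show "(Y has_vector_derivative Y' y) (at y)" if "0 < y" "y < 1" for y
      unfolding Y_def Y'_def
      by (intro has_vector_derivative_of_real DERIV_profile m that)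
    show "(Y' has_vector_derivative Y'' y) (at y)" if "0 < y" "y < 1" for y
      unfolding Y'_def Y''_def
      by (intro has_vector_derivative_of_real DERIV_profile' m that)
    show "(T has_vector_derivative T' t) (at t)" if "0 < t" "t < 1" for t
      unfolding T_def T'_def by (intro has_vector_derivative_exp_powr k that)
  qed
  have "continuous_on (closure Omega) (\<lambda>q. X (fst q) * Y (fst (snd q)) * T (snd (snd q)))"
    unfolding closure_Omega X_def Y_def T_def
    by (intro continuous_intros continuous_on_compose2[OF continuous_on_profile[OF n]]
        continuous_on_compose2[OF continuous_on_profile[OF m]]
        continuous_on_compose2[OF continuous_on_exp_powr[OF k]]) auto
  hence "continuous_on (closure Omega) ?u"
    by (rule continuous_on_eq) (auto simp: closure_Omega uXYT)
  moreover have "C221 ?u"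
  proof (rule C221)
    show "continuous_on {0<..<1} X''" unfolding X''_def
      by (intro continuous_intros continuous_on_subset[OF continuous_on_profile]
          continuous_on_subset[OF continuous_on_powr_nonneg] n) auto
    show "continuous_on {0<..<1} Y''" unfolding Y''_def
      by (intro continuous_intros continuous_on_subset[OF continuous_on_profile]
          continuous_on_subset[OF continuous_on_powr_nonneg] m) auto
    show "continuous_on {0<..<1} T'" unfolding T'_def
      by (intro continuous_intros continuous_on_subset[OF continuous_on_exp_powr]
          continuous_on_subset[OF continuous_on_powr_nonneg] k) auto
  qed
  moreover have "of_real (x powr n * y powr m) * d_t ?u (x, y, t) =
          of_real (t powr k * y powr m) * d_x (d_x ?u) (x, y, t)
          + of_real (t powr k * x powr n) * d_y (d_y ?u) (x, y, t)
          - ?lam * of_real (t powr k * x powr n * y powr m) * ?u (x, y, t)"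
    if q: "(x, y, t) \<in> Omega" for x y t
  proof -
    define lam where "lam = ?lam"
    have X2: "X'' x = - of_real (\<mu>1 * x powr n) * X x"
      unfolding X''_def X_def cd by (simp add: mult_ac)
    have Y2: "Y'' y = - of_real (\<mu>2 * y powr m) * Y y"
      unfolding Y''_def Y_def cd by (simp add: mult_ac)
    have "T' t = - (L * of_real (k + 1)) * of_real (t powr k) * T t"
      unfolding T'_def T_def by (simp add: mult_ac)
    hence T1: "T' t = - (lam + of_real (\<mu>1 + \<mu>2)) * of_real (t powr k) * T t"
      unfolding lam lam_def by simp
    show ?thesis
      unfolding d_t[OF q] d_xx[OF q] d_yy[OF q] separated.u[OF separated_axioms q] X2 Y2 T1
        lam_def[symmetric]
      by (simp add: algebra_simps)
  qed
  moreover have "?u q = 0" if "q \<in> S2 \<union> S3 \<union> S4 \<union> S5" for q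
  proof -
    have "X 0 = 0" "Y 0 = 0" by (simp_all add: X_def Y_def profile_def)
    moreover have "X 1 = 0" "Y 1 = 0" by (simp_all add: X_def Y_def zero)
    ultimately show ?thesis using that by (auto simp: S2_def S3_def S4_def S5_def uXYT)
  qed
  moreover have "?u (x, y, 0) = Complex \<alpha>1 \<alpha>2 * ?u (x, y, 1)" if "x \<in> {0..1}" "y \<in> {0..1}" for x y
  proof -
    \<comment> \<open>\<open>T 0 = 1\<close> since \<open>0 powr (k + 1) = 0\<close>, while
      \<open>T 1 = exp (- L)\<close> is the inverse of \<alpha>, as \<open>s\<close> is
      admissible.\<close>
    have "T 0 = Complex \<alpha>1 \<alpha>2 * T 1"
      using exp_log_alpha[OF r s] by (simp add: T_def exp_minus L_def flip: exp_log_alpha[OF r s])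
    thus ?thesis using that by (simp add: uXYT)
  qed
  ultimately show "problem1 n m k ?lam (Complex \<alpha>1 \<alpha>2) ?u"
    unfolding problem1_def by blast
  assume "D \<noteq> 0"
  obtain x where x: "0 < x" "x < 1" "profile n c x \<noteq> 0" using profile_nonzero[OF n] .
  obtain y where y: "0 < y" "y < 1" "profile m d y \<noteq> 0" using profile_nonzero[OF m] .
  \<comment> \<open>The bottom face belongs to the closure, and there the time factor is 1.\<close>
  have "?u (x, y, 0) \<noteq> 0"
    using x y K \<open>D \<noteq> 0\<close> by (simp add: uXYT X_def Y_def T_def)
  thus "\<exists>q \<in> closure Omega. ?u q \<noteq> 0"
    using x y by (intro bexI[of _ "(x, y, 0)"]) (auto simp: closure_Omega)
qed

text \<open>The scaling between zeros and eigenvalues amounts to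
  \<open>\<omega> / (n + 2)\<^sup>2 = (z / 2)\<^sup>2\<close>, the parameter for which
  \<open>profile\<close> vanishes at 1 exactly when \<open>J_\<nu>\<close> vanishes at
  \<open>z\<close>. The last claim relies on the enumeration reaching every positive zero.\<close>

lemma bessel_zero_eigenvalue:
  assumes n: "n > 0"
    and z: "bij_betw z {1..} {x. 0 < x \<and> bessel_J (1 / (n + 2)) x = 0}"
    and "\<forall>l\<ge>1. \<mu> l = ((n + 2) / 2 * z l)\<^sup>2"
  shows "l \<ge> 1 \<Longrightarrow> \<mu> l > 0"
    and "l \<ge> 1 \<Longrightarrow> profile n (\<mu> l / (n + 2)\<^sup>2) 1 = 0"
    and "\<omega> > 0 \<Longrightarrow> profile n (\<omega> / (n + 2)\<^sup>2) 1 = 0 \<Longrightarrow> \<exists>l\<ge>1. \<omega> = \<mu> l"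
proof -
  have \<mu>: "\<mu> l = ((n + 2) / 2 * z l)\<^sup>2" if "l \<ge> 1" for l using assms(3) that by blast
  {
    assume l: "l \<ge> 1"
    hence zl: "z l > 0" "bessel_J (1 / (n + 2)) (z l) = 0"
      using bij_betwE[OF z] by auto
    show "\<mu> l > 0" using \<mu>[OF l] zl n by simp
    have "(n + 2) / 2 * z l / (n + 2) = z l / 2" using n by (simp add: field_simps)
    hence "\<mu> l / (n + 2)\<^sup>2 = (z l / 2)\<^sup>2"
      unfolding \<mu>[OF l] power_divide[symmetric] by (simp only:)
    thus "profile n (\<mu> l / (n + 2)\<^sup>2) 1 = 0"
      using bessel_J_zero_iff_profile[OF n zl(1)] zl(2) by (simp only: simp_thms)
  next
    assume \<omega>: "\<omega> > 0" and zero: "profile n (\<omega> / (n + 2)\<^sup>2) 1 = 0"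
    \<comment> \<open>The inverse of the scaling: the candidate zero belonging to the eigenvalue
      \<omega>.\<close>
    define w where "w = 2 * sqrt \<omega> / (n + 2)"
    have w: "w > 0" using \<omega> n by (simp add: w_def)
    have "w / 2 = sqrt \<omega> / (n + 2)" using n by (simp add: w_def field_simps)
    hence "(w / 2)\<^sup>2 = \<omega> / (n + 2)\<^sup>2"
      using \<omega> by (simp only: power_divide real_sqrt_pow2 less_imp_le)
    with zero bessel_J_zero_iff_profile[OF n w] have "bessel_J (1 / (n + 2)) w = 0" by (simp only: simp_thms)
    with w z have "w \<in> z ` {1..}" unfolding bij_betw_def by blast
    then obtain l where l: "l \<ge> 1" "w = z l" by auto
    have "(n + 2) / 2 * w = sqrt \<omega>" using n by (simp add: w_def)
    hence "\<mu> l = \<omega>" using \<mu>[OF l(1)] l(2) \<omega> by simp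
    thus "\<exists>l\<ge>1. \<omega> = \<mu> l" using l(1) by blast
  }
qed

text \<open>The given factors \<open>X0\<close>, \<open>Y0\<close>, \<open>T0\<close> carry no
  regularity, so they are replaced by slices of \<open>u\<close> through a point where
  \<open>u\<close> is non-zero, which inherit the regularity of \<open>u\<close>. Freezing two
  variables in the equation then isolates one ordinary differential equation per factor.\<close>

lemma separated_solution_unique:
  assumes n: "n > 0" and m: "m > 0" and k: "k > 0" and r: "\<alpha>1\<^sup>2 + \<alpha>2\<^sup>2 \<noteq> 0"
    and P: "problem1 n m k lam (Complex \<alpha>1 \<alpha>2) u"
    and sep: "\<And>x y t. (x, y, t) \<in> closure Omega \<Longrightarrow> u (x, y, t) = X0 x * Y0 y * T0 t"
    and nz: "q \<in> closure Omega" "u q \<noteq> 0"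
  obtains s \<omega>1 \<omega>2 D where "s \<in> admissible \<alpha>1" "\<omega>1 > 0" "\<omega>2 > 0"
    "profile n (\<omega>1 / (n + 2)\<^sup>2) 1 = 0" "profile m (\<omega>2 / (m + 2)\<^sup>2) 1 = 0" "D \<noteq> 0"
    "lam = Complex (lambda1 k \<alpha>1 \<alpha>2 (\<omega>1 + \<omega>2)) (lambda2 k \<alpha>1 \<alpha>2 s)"
    "\<And>q. q \<in> closure Omega \<Longrightarrow> u q = u_sol n m k \<alpha>1 \<alpha>2 \<omega>1 \<omega>2 s D q"
proof -
  have cu: "continuous_on (closure Omega) u" and C: "C221 u"
    using P by (simp_all add: problem1_def)
  have pde: "of_real (x powr n * y powr m) * d_t u (x, y, t) =
          of_real (t powr k * y powr m) * d_x (d_x u) (x, y, t)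
          + of_real (t powr k * x powr n) * d_y (d_y u) (x, y, t)
          - lam * of_real (t powr k * x powr n * y powr m) * u (x, y, t)"
    if "(x, y, t) \<in> Omega" for x y t
    using P that unfolding problem1_def by blast
  have bdry: "u q = 0" if "q \<in> S2 \<union> S3 \<union> S4 \<union> S5" for q
    using P that unfolding problem1_def by blast
  have nonlocal: "u (x, y, 0) = Complex \<alpha>1 \<alpha>2 * u (x, y, 1)" if "x \<in> {0..1}" "y \<in> {0..1}" for x y
    using P that unfolding problem1_def by blast
  \<comment> \<open>If \<open>u\<close> vanished on the open cube, continuity would make it vanish
    on the closure.\<close>
  obtain x0 y0 t0 where q0: "(x0, y0, t0) \<in> Omega" "u (x0, y0, t0) \<noteq> 0"
  proof (rule ccontr)
    assume "\<not> thesis"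
    with that have "u p = 0" if "p \<in> Omega" for p using that by (cases p) blast
    hence "u q = 0" by (rule continuous_constant_on_closure[OF cu _ nz(1)])
    with nz(2) show False ..
  qed
  hence in0: "0 < x0" "x0 < 1" "0 < y0" "y0 < 1" "0 < t0" "t0 < 1" by (auto simp: Omega_def)
  have Omega_closure: "p \<in> Omega \<Longrightarrow> p \<in> closure Omega" for p using closure_subset by blast
  define U where "U = u (x0, y0, t0)"
  have U: "U \<noteq> 0" "U = X0 x0 * Y0 y0 * T0 t0"
    using q0 sep[OF Omega_closure[OF q0(1)]] by (auto simp: U_def)
  \<comment> \<open>The value \<open>U\<close> at the base point stays in the first factor; the
    other two are normalised to 1 there, so that the product reproduces \<open>u\<close> without a
    further constant.\<close>
  define X X' X'' Y Y' Y'' T T' where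
    "X = (\<lambda>x. u (x, y0, t0))" and "X' = (\<lambda>x. d_x u (x, y0, t0))" and
    "X'' = (\<lambda>x. d_x (d_x u) (x, y0, t0))" and
    "Y = (\<lambda>y. u (x0, y, t0) / U)" and "Y' = (\<lambda>y. d_y u (x0, y, t0) / U)" and
    "Y'' = (\<lambda>y. d_y (d_y u) (x0, y, t0) / U)" and
    "T = (\<lambda>t. u (x0, y0, t) / U)" and "T' = (\<lambda>t. d_t u (x0, y0, t) / U)"
  have at0: "X x0 = U" "Y y0 = 1" "T t0 = 1" using U(1) by (auto simp: X_def Y_def T_def U_def)
  have uXYT: "u (x, y, t) = X x * Y y * T t" if "(x, y, t) \<in> closure Omega" for x y t
  proof -
    have "X x = X0 x * Y0 y0 * T0 t0" unfolding X_def
      by (rule sep) (use that in0 in \<open>auto simp: closure_Omega\<close>)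
    moreover have "u (x0, y, t0) = X0 x0 * Y0 y * T0 t0"
      by (rule sep) (use that in0 in \<open>auto simp: closure_Omega\<close>)
    moreover have "u (x0, y0, t) = X0 x0 * Y0 y0 * T0 t"
      by (rule sep) (use that in0 in \<open>auto simp: closure_Omega\<close>)
    ultimately show ?thesis
      using sep[OF that] U by (simp add: Y_def T_def)
  qed
  interpret separated u X X' X'' Y Y' Y'' T T'
  proof
    show "u (x, y, t) = X x * Y y * T t" if "(x, y, t) \<in> Omega" for x y t
      by (rule uXYT[OF Omega_closure[OF that]])
    have diff: "(\<lambda>\<xi>. u (\<xi>, y, t)) differentiable (at x)"
        "(\<lambda>\<xi>. d_x u (\<xi>, y, t)) differentiable (at x)"
        "(\<lambda>\<eta>. u (x, \<eta>, t)) differentiable (at y)"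
        "(\<lambda>\<eta>. d_y u (x, \<eta>, t)) differentiable (at y)"
        "(\<lambda>\<tau>. u (x, y, \<tau>)) differentiable (at t)" if "(x, y, t) \<in> Omega" for x y t
      using C that unfolding C221_def by blast+
    have in_x: "(x, y0, t0) \<in> Omega" and in_y: "(x0, x, t0) \<in> Omega" and in_t: "(x0, y0, x) \<in> Omega"
      if "0 < x" "x < 1" for x using that in0 by (auto simp: Omega_def)
    show "(X has_vector_derivative X' x) (at x)" if "0 < x" "x < 1" for x
      using diff(1)[OF in_x[OF that]] unfolding vector_derivative_works X_def X'_def
      by (simp add: d_x_def)
    show "(X' has_vector_derivative X'' x) (at x)" if "0 < x" "x < 1" for x
      using diff(2)[OF in_x[OF that]] unfolding vector_derivative_works X'_def X''_def
      by (simp add: d_x_def[of "d_x u"])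
    show "(Y has_vector_derivative Y' y) (at y)" if "0 < y" "y < 1" for y
      using diff(3)[OF in_y[OF that]] unfolding vector_derivative_works Y_def Y'_def
      by (intro has_vector_derivative_divide) (simp add: d_y_def)
    show "(Y' has_vector_derivative Y'' y) (at y)" if "0 < y" "y < 1" for y
      using diff(4)[OF in_y[OF that]] unfolding vector_derivative_works Y'_def Y''_def
      by (intro has_vector_derivative_divide) (simp add: d_y_def[of "d_y u"])
    show "(T has_vector_derivative T' t) (at t)" if "0 < t" "t < 1" for t
      using diff(5)[OF in_t[OF that]] unfolding vector_derivative_works T_def T'_def
      by (intro has_vector_derivative_divide) (simp add: d_t_def)
  qed
  have eq: "of_real (x powr n) * of_real (y powr m) * (T' t * (X x * Y y)) =
      of_real (t powr k) * of_real (y powr m) * (X'' x * (Y y * T t))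
      + of_real (t powr k) * of_real (x powr n) * (Y'' y * (X x * T t))
      - lam * (of_real (t powr k) * of_real (x powr n) * of_real (y powr m)) * (X x * Y y * T t)"
    if "0 < x" "x < 1" "0 < y" "y < 1" "0 < t" "t < 1" for x y t
  proof -
    have q: "(x, y, t) \<in> Omega" using that by (simp add: Omega_def)
    show ?thesis
      using pde[OF q] unfolding d_t[OF q] d_xx[OF q] d_yy[OF q] uXYT[OF Omega_closure[OF q]]
      by (simp only: of_real_mult)
  qed
  define a b c :: complex where "a = of_real (x0 powr n)" and "b = of_real (y0 powr m)" and "c = of_real (t0 powr k)"
  have abc: "a \<noteq> 0" "b \<noteq> 0" "c \<noteq> 0" using in0 by (auto simp: a_def b_def c_def)
  define \<mu>1 where "\<mu>1 = Y'' y0 / b - lam - T' t0 / c"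
  define \<mu>2 where "\<mu>2 = X'' x0 / (a * U) - lam - T' t0 / c"
  have X2: "X'' x = - \<mu>1 * of_real (x powr n) * X x" if "0 < x" "x < 1" for x
    using eq[OF that in0(3-6)] abc unfolding at0 \<mu>1_def b_def[symmetric] c_def[symmetric]
    by (simp add: divide_simps) algebra
  have Y2: "Y'' y = - \<mu>2 * of_real (y powr m) * Y y" if "0 < y" "y < 1" for y
    using eq[OF in0(1,2) that in0(5,6)] abc U(1) unfolding at0 \<mu>2_def a_def[symmetric] c_def[symmetric]
    by (simp add: divide_simps) algebra
  \<comment> \<open>With both spatial equations inserted at \<open>(x0, y0)\<close>, the common
    factor \<open>a * b * U\<close> is non-zero and cancels.\<close>
  have T1: "T' t = - ((lam + (\<mu>1 + \<mu>2)) * of_real (t powr k) * T t)" if "0 < t" "t < 1" for t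
  proof -
    have "a * b * U * T' t = a * b * U * - ((lam + (\<mu>1 + \<mu>2)) * of_real (t powr k) * T t)"
      using eq[OF in0(1-4) that]
      unfolding at0 X2[OF in0(1,2)] Y2[OF in0(3,4)] a_def[symmetric] b_def[symmetric]
      by (simp add: algebra_simps)
    thus ?thesis by (rule mult_left_cancel[THEN iffD1, rotated]) (use abc U in simp)
  qed
  have cX: "continuous_on {0..1} X" unfolding X_def
    by (rule continuous_on_compose2[OF cu]) (use in0 in \<open>auto simp: closure_Omega intro!: continuous_intros\<close>)
  have "continuous_on {0..1} (\<lambda>y. u (x0, y, t0))"
    by (rule continuous_on_compose2[OF cu]) (use in0 in \<open>auto simp: closure_Omega intro!: continuous_intros\<close>)
  hence cY: "continuous_on {0..1} Y" unfolding Y_def by (intro continuous_intros) (use U in auto)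
  have "continuous_on {0..1} (\<lambda>t. u (x0, y0, t))"
    by (rule continuous_on_compose2[OF cu]) (use in0 in \<open>auto simp: closure_Omega intro!: continuous_intros\<close>)
  hence cT: "continuous_on {0..1} T" unfolding T_def by (intro continuous_intros) (use U in auto)
  have X01: "X 0 = 0" "X 1 = 0" unfolding X_def
    by (rule bdry, use in0 in \<open>simp add: S2_def S3_def S4_def S5_def\<close>)+
  have Y01: "Y 0 = 0" "Y 1 = 0"
    using bdry[of "(x0, 0, t0)"] bdry[of "(x0, 1, t0)"] in0
    by (simp_all add: Y_def S2_def S3_def S4_def S5_def)
  obtain \<omega>1 A where A: "\<omega>1 > 0" "\<mu>1 = of_real \<omega>1" "A \<noteq> 0"
    "\<And>x. x \<in> {0..1} \<Longrightarrow> X x = A * of_real (profile n (\<omega>1 / (n + 2)\<^sup>2) x)"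
    "profile n (\<omega>1 / (n + 2)\<^sup>2) 1 = 0"
  proof (rule weighted_string_dirichlet[OF n cX X01, where X' = X' and \<mu> = \<mu>1 and ?x0.0 = x0])
    show "(X has_vector_derivative X' x) (at x)" if "0 < x" "x < 1" for x by (rule X(1)[OF that])
    show "(X' has_vector_derivative - \<mu>1 * of_real (x powr n) * X x) (at x)" if "0 < x" "x < 1" for x
      using X(2)[OF that] unfolding X2[OF that] .
  qed (use in0 U at0 in \<open>auto intro: that\<close>)
  obtain \<omega>2 B where B: "\<omega>2 > 0" "\<mu>2 = of_real \<omega>2" "B \<noteq> 0"
    "\<And>y. y \<in> {0..1} \<Longrightarrow> Y y = B * of_real (profile m (\<omega>2 / (m + 2)\<^sup>2) y)"
    "profile m (\<omega>2 / (m + 2)\<^sup>2) 1 = 0"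
  proof (rule weighted_string_dirichlet[OF m cY Y01, where X' = Y' and \<mu> = \<mu>2 and ?x0.0 = y0])
    show "(Y has_vector_derivative Y' y) (at y)" if "0 < y" "y < 1" for y by (rule Y(1)[OF that])
    show "(Y' has_vector_derivative - \<mu>2 * of_real (y powr m) * Y y) (at y)" if "0 < y" "y < 1" for y
      using Y(2)[OF that] unfolding Y2[OF that] .
  qed (use in0 U at0 in \<open>auto intro: that\<close>)
  have \<mu>: "\<mu>1 + \<mu>2 = of_real (\<omega>1 + \<omega>2)" by (simp add: A B)
  have "T_problem k (Complex \<alpha>1 \<alpha>2) lam (\<omega>1 + \<omega>2) T"
    unfolding T_problem_def
  proof (intro conjI ballI)
    fix t :: real assume "t \<in> {0<..<1}"
    hence t: "0 < t" "t < 1" by auto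
    show "T differentiable (at t)" by (rule differentiableI_vector[OF T[OF t]])
    show "vector_derivative T (at t) + (lam + of_real (\<omega>1 + \<omega>2)) * of_real (t powr k) * T t = 0"
      unfolding vector_derivative_at[OF T[OF t]] T1[OF t] \<mu> by simp
  next
    show "T 0 = Complex \<alpha>1 \<alpha>2 * T 1"
      unfolding T_def using nonlocal[of x0 y0] in0 by simp
  qed (rule cT)
  moreover have "\<exists>t\<in>{0..1}. T t \<noteq> 0" using at0 in0 by (intro bexI[of _ t0]) auto
  ultimately obtain E where e: "exp ((lam + of_real (\<omega>1 + \<omega>2)) / of_real (k + 1)) = Complex \<alpha>1 \<alpha>2"
    and E: "E \<noteq> 0" "\<And>t. t \<in> {0..1} \<Longrightarrow>
      T t = E * exp (- ((lam + of_real (\<omega>1 + \<omega>2)) / of_real (k + 1)) * of_real (t powr (k + 1)))"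
    using T_problem_iff[OF k, of "Complex \<alpha>1 \<alpha>2" lam "\<omega>1 + \<omega>2" T] by blast
  have "exp ((Complex (Re lam) (Im lam) + of_real (\<omega>1 + \<omega>2)) / of_real (k + 1)) = Complex \<alpha>1 \<alpha>2"
    using e by (simp only: complex_surj)
  from exp_eq_alpha_imp[OF k this] obtain s where s: "s \<in> admissible \<alpha>1"
    and Re: "Re lam = lambda1 k \<alpha>1 \<alpha>2 (\<omega>1 + \<omega>2)" and Im: "Im lam = lambda2 k \<alpha>1 \<alpha>2 s"
    using nonlocal_equations_iff[OF r k, of "Re lam" "\<omega>1 + \<omega>2" "Im lam"] by blast
  have lam: "lam = Complex (lambda1 k \<alpha>1 \<alpha>2 (\<omega>1 + \<omega>2)) (lambda2 k \<alpha>1 \<alpha>2 s)"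
    using Re Im by (simp add: complex_eq_iff)
  have T_eq: "T t = E * time_factor k \<alpha>1 \<alpha>2 s t" if "t \<in> {0..1}" for t
    using E(2)[OF that] unfolding lam lambda_eq_log_alpha[OF r k] time_factor_eq .
  obtain K where K: "K > 0" and u_sol: "\<And>s D x y t. 0 \<le> x \<Longrightarrow> 0 \<le> y \<Longrightarrow>
      u_sol n m k \<alpha>1 \<alpha>2 \<omega>1 \<omega>2 s D (x, y, t) =
      D * of_real K * of_real (profile n (\<omega>1 / (n + 2)\<^sup>2) x) * of_real (profile m (\<omega>2 / (m + 2)\<^sup>2) y)
        * time_factor k \<alpha>1 \<alpha>2 s t"
    using u_sol_eq[OF n m A(1) B(1)] by metis
  \<comment> \<open>The product of the three factor constants, divided by the normalisation
    \<open>K\<close> already contained in \<open>u_sol\<close>.\<close>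
  define D where "D = A * B * E / of_real K"
  have "D \<noteq> 0" using A B E K by (simp add: D_def)
  moreover have "u p = u_sol n m k \<alpha>1 \<alpha>2 \<omega>1 \<omega>2 s D p" if "p \<in> closure Omega" for p
  proof -
    obtain x y t where p: "p = (x, y, t)" by (cases p)
    hence i: "x \<in> {0..1}" "y \<in> {0..1}" "t \<in> {0..1}" using that by (auto simp: closure_Omega)
    hence "0 \<le> x" "0 \<le> y" by auto
    show ?thesis
      unfolding p uXYT[OF that[unfolded p]] A(4)[OF i(1)] B(4)[OF i(2)] T_eq[OF i(3)]
        u_sol[OF \<open>0 \<le> x\<close> \<open>0 \<le> y\<close>] D_def
      using K by simp
  qed
  ultimately show thesis using that[OF s A(1) B(1) A(5) B(5) _ lam] by blast
qed

theorem mainTheorem2: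
  fixes m n k \<alpha>1 \<alpha>2 :: real
    and z1 z2 \<mu>1 \<mu>2 :: "nat \<Rightarrow> real"
  assumes "m > 0" and "n > 0" and "k > 0"
    and "\<alpha>1\<^sup>2 + \<alpha>2\<^sup>2 \<noteq> 0"
    and "bij_betw z1 {1..} {x. 0 < x \<and> bessel_J (1 / (n + 2)) x = 0}"
    and "bij_betw z2 {1..} {y. 0 < y \<and> bessel_J (1 / (m + 2)) y = 0}"
    and "\<And>l. l \<ge> 1 \<Longrightarrow> \<mu>1 l = ((n + 2) / 2 * z1 l)\<^sup>2"
    and "\<And>p. p \<ge> 1 \<Longrightarrow> \<mu>2 p = ((m + 2) / 2 * z2 p)\<^sup>2"
  shows
   "(\<forall>l\<ge>1. \<forall>p\<ge>1. \<forall>lam1 lam2.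
       (\<exists>T. T_problem k (Complex \<alpha>1 \<alpha>2) (Complex lam1 lam2) (\<mu>1 l + \<mu>2 p) T \<and> (\<exists>t\<in>{0..1}. T t \<noteq> 0)) \<longrightarrow>
         \<alpha>1 / (\<alpha>1\<^sup>2 + \<alpha>2\<^sup>2) = exp (- (lam1 + (\<mu>1 l + \<mu>2 p)) / (k + 1)) * cos (lam2 / (k + 1)) \<and>
         \<alpha>2 / (\<alpha>1\<^sup>2 + \<alpha>2\<^sup>2) = exp (- (lam1 + (\<mu>1 l + \<mu>2 p)) / (k + 1)) * sin (lam2 / (k + 1))) \<and>
    (\<forall>l\<ge>1. \<forall>p\<ge>1. \<forall>lam1 lam2.
       (\<alpha>1 / (\<alpha>1\<^sup>2 + \<alpha>2\<^sup>2) = exp (- (lam1 + (\<mu>1 l + \<mu>2 p)) / (k + 1)) * cos (lam2 / (k + 1)) \<and>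
        \<alpha>2 / (\<alpha>1\<^sup>2 + \<alpha>2\<^sup>2) = exp (- (lam1 + (\<mu>1 l + \<mu>2 p)) / (k + 1)) * sin (lam2 / (k + 1)))
       \<longleftrightarrow> (lam1 = lambda1 k \<alpha>1 \<alpha>2 (\<mu>1 l + \<mu>2 p) \<and> (\<exists>s\<in>admissible \<alpha>1. lam2 = lambda2 k \<alpha>1 \<alpha>2 s))) \<and>
    (\<forall>l\<ge>1. \<forall>p\<ge>1. \<forall>s\<in>admissible \<alpha>1. \<forall>T.
       (T_problem k (Complex \<alpha>1 \<alpha>2)
          (Complex (lambda1 k \<alpha>1 \<alpha>2 (\<mu>1 l + \<mu>2 p)) (lambda2 k \<alpha>1 \<alpha>2 s)) (\<mu>1 l + \<mu>2 p) T \<and>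
        (\<exists>t\<in>{0..1}. T t \<noteq> 0))
       \<longleftrightarrow> (\<exists>C. C \<noteq> 0 \<and> (\<forall>t\<in>{0..1}. T t = C * time_factor k \<alpha>1 \<alpha>2 s t))) \<and>
    (\<forall>l\<ge>1. \<forall>p\<ge>1. \<forall>s\<in>admissible \<alpha>1. \<forall>D.
       problem1 n m k
         (Complex (lambda1 k \<alpha>1 \<alpha>2 (\<mu>1 l + \<mu>2 p)) (lambda2 k \<alpha>1 \<alpha>2 s)) (Complex \<alpha>1 \<alpha>2)
         (u_sol n m k \<alpha>1 \<alpha>2 (\<mu>1 l) (\<mu>2 p) s D) \<and>
       (D \<noteq> 0 \<longrightarrow>
          (\<exists>q \<in> closure Omega. u_sol n m k \<alpha>1 \<alpha>2 (\<mu>1 l) (\<mu>2 p) s D q \<noteq> 0))) \<and>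
    (\<forall>lam u X Y T.
       problem1 n m k lam (Complex \<alpha>1 \<alpha>2) u \<and>
       (\<forall>(x, y, t) \<in> closure Omega. u (x, y, t) = X x * Y y * T t) \<and>
       (\<exists>q \<in> closure Omega. u q \<noteq> 0) \<longrightarrow>
       (\<exists>l\<ge>1. \<exists>p\<ge>1. \<exists>s\<in>admissible \<alpha>1. \<exists>D. D \<noteq> 0 \<and>
          lam = Complex (lambda1 k \<alpha>1 \<alpha>2 (\<mu>1 l + \<mu>2 p)) (lambda2 k \<alpha>1 \<alpha>2 s) \<and>
          (\<forall>q \<in> closure Omega. u q = u_sol n m k \<alpha>1 \<alpha>2 (\<mu>1 l) (\<mu>2 p) s D q)))"
proof (intro conjI allI impI ballI)
  note n = \<open>n > 0\<close> and m = \<open>m > 0\<close> and k = \<open>k > 0\<close> and r = \<open>\<alpha>1\<^sup>2 + \<alpha>2\<^sup>2 \<noteq> 0\<close>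
  have "\<forall>l\<ge>1. \<mu>1 l = ((n + 2) / 2 * z1 l)\<^sup>2" "\<forall>p\<ge>1. \<mu>2 p = ((m + 2) / 2 * z2 p)\<^sup>2"
    using assms(7,8) by blast+
  note \<mu>1 = bessel_zero_eigenvalue[OF n assms(5) this(1)]
    and \<mu>2 = bessel_zero_eigenvalue[OF m assms(6) this(2)]
  {
    fix l p lam1 lam2
    assume "\<exists>T. T_problem k (Complex \<alpha>1 \<alpha>2) (Complex lam1 lam2) (\<mu>1 l + \<mu>2 p) T \<and> (\<exists>t\<in>{0..1}. T t \<noteq> 0)"
    hence "exp ((Complex lam1 lam2 + of_real (\<mu>1 l + \<mu>2 p)) / of_real (k + 1)) = Complex \<alpha>1 \<alpha>2"
      using T_problem_iff[OF k] by blast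
    from exp_eq_alpha_imp[OF k this]
    show "\<alpha>1 / (\<alpha>1\<^sup>2 + \<alpha>2\<^sup>2) = exp (- (lam1 + (\<mu>1 l + \<mu>2 p)) / (k + 1)) * cos (lam2 / (k + 1))"
      "\<alpha>2 / (\<alpha>1\<^sup>2 + \<alpha>2\<^sup>2) = exp (- (lam1 + (\<mu>1 l + \<mu>2 p)) / (k + 1)) * sin (lam2 / (k + 1))" .
  next
    fix l p lam1 lam2
    show "(\<alpha>1 / (\<alpha>1\<^sup>2 + \<alpha>2\<^sup>2) = exp (- (lam1 + (\<mu>1 l + \<mu>2 p)) / (k + 1)) * cos (lam2 / (k + 1)) \<and>
        \<alpha>2 / (\<alpha>1\<^sup>2 + \<alpha>2\<^sup>2) = exp (- (lam1 + (\<mu>1 l + \<mu>2 p)) / (k + 1)) * sin (lam2 / (k + 1)))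
       \<longleftrightarrow> (lam1 = lambda1 k \<alpha>1 \<alpha>2 (\<mu>1 l + \<mu>2 p) \<and> (\<exists>s\<in>admissible \<alpha>1. lam2 = lambda2 k \<alpha>1 \<alpha>2 s))"
      by (rule nonlocal_equations_iff[OF r k])
  next
    fix l p s T assume s: "s \<in> admissible \<alpha>1"
    \<comment> \<open>For admissible \<open>s\<close> the scalar condition in
      \<open>T_problem_iff\<close> holds, so only the free constant \<open>C\<close>
      remains.\<close>
    show "(T_problem k (Complex \<alpha>1 \<alpha>2)
          (Complex (lambda1 k \<alpha>1 \<alpha>2 (\<mu>1 l + \<mu>2 p)) (lambda2 k \<alpha>1 \<alpha>2 s)) (\<mu>1 l + \<mu>2 p) T \<and>
        (\<exists>t\<in>{0..1}. T t \<noteq> 0))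
       \<longleftrightarrow> (\<exists>C. C \<noteq> 0 \<and> (\<forall>t\<in>{0..1}. T t = C * time_factor k \<alpha>1 \<alpha>2 s t))"
      unfolding T_problem_iff[OF k] lambda_eq_log_alpha[OF r k] time_factor_eq
      using exp_log_alpha[OF r s] by blast
  next
    fix l p :: nat and s D assume l: "l \<ge> 1" and p: "p \<ge> 1" and s: "s \<in> admissible \<alpha>1"
    note sol = problem1_u_sol[OF n m k r s \<mu>1(1)[OF l] \<mu>2(1)[OF p] \<mu>1(2)[OF l] \<mu>2(2)[OF p], of D]
    show "problem1 n m k
         (Complex (lambda1 k \<alpha>1 \<alpha>2 (\<mu>1 l + \<mu>2 p)) (lambda2 k \<alpha>1 \<alpha>2 s)) (Complex \<alpha>1 \<alpha>2)
         (u_sol n m k \<alpha>1 \<alpha>2 (\<mu>1 l) (\<mu>2 p) s D)" by (rule sol(1))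
    show "\<exists>q \<in> closure Omega. u_sol n m k \<alpha>1 \<alpha>2 (\<mu>1 l) (\<mu>2 p) s D q \<noteq> 0" if "D \<noteq> 0"
      by (rule sol(2)[OF that])
  next
    fix lam u X Y T
    assume H: "problem1 n m k lam (Complex \<alpha>1 \<alpha>2) u \<and>
       (\<forall>(x, y, t) \<in> closure Omega. u (x, y, t) = X x * Y y * T t) \<and>
       (\<exists>q \<in> closure Omega. u q \<noteq> 0)"
    then obtain q where q: "q \<in> closure Omega" "u q \<noteq> 0" by blast
    have "problem1 n m k lam (Complex \<alpha>1 \<alpha>2) u"
      and "\<And>x y t. (x, y, t) \<in> closure Omega \<Longrightarrow> u (x, y, t) = X x * Y y * T t" using H by blast+
    from separated_solution_unique[OF n m k r this q]
    obtain s \<omega>1 \<omega>2 D where s: "s \<in> admissible \<alpha>1" and \<omega>: "\<omega>1 > 0" "\<omega>2 > 0"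
      "profile n (\<omega>1 / (n + 2)\<^sup>2) 1 = 0" "profile m (\<omega>2 / (m + 2)\<^sup>2) 1 = 0" and D: "D \<noteq> 0"
      "lam = Complex (lambda1 k \<alpha>1 \<alpha>2 (\<omega>1 + \<omega>2)) (lambda2 k \<alpha>1 \<alpha>2 s)"
      "\<And>q. q \<in> closure Omega \<Longrightarrow> u q = u_sol n m k \<alpha>1 \<alpha>2 \<omega>1 \<omega>2 s D q" by blast
    \<comment> \<open>Both separation constants are matched with indices in the given enumerations
      of the Bessel zeros.\<close>
    obtain l p where "l \<ge> 1" "\<omega>1 = \<mu>1 l" "p \<ge> 1" "\<omega>2 = \<mu>2 p"
      using \<mu>1(3)[OF \<omega>(1,3)] \<mu>2(3)[OF \<omega>(2,4)] by blast
    with s D show "\<exists>l\<ge>1. \<exists>p\<ge>1. \<exists>s\<in>admissible \<alpha>1. \<exists>D. D \<noteq> 0 \<and>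
          lam = Complex (lambda1 k \<alpha>1 \<alpha>2 (\<mu>1 l + \<mu>2 p)) (lambda2 k \<alpha>1 \<alpha>2 s) \<and>
          (\<forall>q \<in> closure Omega. u q = u_sol n m k \<alpha>1 \<alpha>2 (\<mu>1 l) (\<mu>2 p) s D q)"
      by blast
  }
qed

end
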